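(* Let $\{x_t\}_{t\in[0,1]}\in\mathscr{H}$ with covariance function $C(s,t)=\tilde C(t-s)$. Then, in mean square and uniformly in $t\in[0,1]$, $$x_t = c_0 Y'_0+\sum_{k=1}^{\infty}c_k\big(Y_k\sqrt2\sin(2k\pi t)+Y'_k\sqrt2\cos(2k\pi t)\big),$$ where $(Y_n)_n$ and $(Y'_n)_n$ are two independent sequences of independent standard Gaussian random variables, and $(c_k)_{k\ge 0}\in\ell^2$ is such that $$c_n^2=\int_0^1\tilde C(s)\cos(2n\pi s)\,ds,\qquad n=0,1,2,\ldots$$
   Context: $\mathscr{H}$ denotes the set of real Gaussian stochastic processes $\{x_t\}_{t\in[0,1]}$ such that: $E(x_t)=0$ for all $t$; the process is continuously stationary, i.e. its covariance function $C(s,t)=\mathrm{Cov}(x_s,x_t)$ satisfies $C(s,t)=\tilde C(s-t)$ for all $s,t$ for some real continuous function $\tilde C$ (the covariogram function); and the process is periodical, i.e. $x_0=x_1$ almost surely. A series $\sum_k f_k(t)$ of random variables converges to $x_t$ in mean square, uniformly in $t$, if $\sup_{t\in[0,1]}E\big[(x_t-\sum_{k\le n}f_k(t))^2\big]\to0$ as $n\to\infty$.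
   Formalization: The Gaussian variables are taken on the given probability space enlarged by independent Gaussian noise, as the space itself may carry none (zero process on one point); each variable with nonzero coefficient c_k in the series is still defined on the original space. *)

theory Defs
  imports "HOL-Probability.Probability"
begin

text \<open>Normal random variables. Point masses are included as the normal laws of variance 0; this is
  needed for Gaussian processes such as those with \<open>x 0 = x 1\<close> almost surely.\<close>

definition gaussian_rv :: "'a measure \<Rightarrow> ('a \<Rightarrow> real) \<Rightarrow> bool" where
  "gaussian_rv M X \<longleftrightarrow> X \<in> borel_measurable M \<and>
     ((\<exists>\<mu> \<sigma>. \<sigma> > 0 \<and> distributed M lborel X (normal_density \<mu> \<sigma>)) \<or>
      (\<exists>\<mu>. AE \<omega> in M. X \<omega> = \<mu>))"

definition standard_gaussian_rv :: "'a measure \<Rightarrow> ('a \<Rightarrow> real) \<Rightarrow> bool" where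
  "standard_gaussian_rv M X \<longleftrightarrow> distributed M lborel X std_normal_density"

definition gaussian_process :: "'a measure \<Rightarrow> 'i set \<Rightarrow> ('i \<Rightarrow> 'a \<Rightarrow> real) \<Rightarrow> bool" where
  "gaussian_process M T x \<longleftrightarrow>
     (\<forall>F a. finite F \<and> F \<subseteq> T \<longrightarrow> gaussian_rv M (\<lambda>\<omega>. \<Sum>t\<in>F. a t * x t \<omega>))"

definition covariance :: "'a measure \<Rightarrow> ('a \<Rightarrow> real) \<Rightarrow> ('a \<Rightarrow> real) \<Rightarrow> real" where
  "covariance M X Y =
     (\<integral>\<omega>. (X \<omega> - (\<integral>\<omega>'. X \<omega>' \<partial>M)) * (Y \<omega> - (\<integral>\<omega>'. Y \<omega>' \<partial>M)) \<partial>M)"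

text \<open>The differences \<open>s - t\<close> range over \<open>[-1, 1]\<close>, so only the values of the
  covariogram on this interval are relevant.\<close>

definition continuously_stationary :: "'a measure \<Rightarrow> (real \<Rightarrow> 'a \<Rightarrow> real) \<Rightarrow> bool" where
  "continuously_stationary M x \<longleftrightarrow>
     (\<exists>C. continuous_on {-1..1} C \<and>
       (\<forall>s\<in>{0..1}. \<forall>t\<in>{0..1}. covariance M (x s) (x t) = C (s - t)))"

definition class_H :: "'a measure \<Rightarrow> (real \<Rightarrow> 'a \<Rightarrow> real) set" where
  "class_H M = {x. gaussian_process M {0..1} x \<and>
                   (\<forall>t\<in>{0..1}. (\<integral>\<omega>. x t \<omega> \<partial>M) = 0) \<and>
                   continuously_stationary M x \<and>
                   (AE \<omega> in M. x 0 \<omega> = x 1 \<omega>)}"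

definition iid_standard_gaussian :: "'a measure \<Rightarrow> (nat \<Rightarrow> 'a \<Rightarrow> real) \<Rightarrow> bool" where
  "iid_standard_gaussian M Y \<longleftrightarrow>
     (\<forall>n. standard_gaussian_rv M (Y n)) \<and> prob_space.indep_vars M (\<lambda>_. borel) Y UNIV"

definition independent_sequences ::
    "'a measure \<Rightarrow> (nat \<Rightarrow> 'a \<Rightarrow> real) \<Rightarrow> (nat \<Rightarrow> 'a \<Rightarrow> real) \<Rightarrow> bool" where
  "independent_sequences M Y Y' \<longleftrightarrow>
     prob_space.indep_var M (\<Pi>\<^sub>M n\<in>UNIV. borel) (\<lambda>\<omega> n. Y n \<omega>) (\<Pi>\<^sub>M n\<in>UNIV. borel) (\<lambda>\<omega> n. Y' n \<omega>)"

text \<open>Uniform mean-square convergence of \<open>S n t\<close> to \<open>x t\<close>. The expectations are taken in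
  \<open>[0, \<infinity>]\<close>, so that a difference that is not square integrable has infinite mean square
  rather than the default value 0 of the Bochner integral.\<close>

definition ms_converges_uniformly ::
    "'a measure \<Rightarrow> 'i set \<Rightarrow> (nat \<Rightarrow> 'i \<Rightarrow> 'a \<Rightarrow> real) \<Rightarrow> ('i \<Rightarrow> 'a \<Rightarrow> real) \<Rightarrow> bool" where
  "ms_converges_uniformly M T S x \<longleftrightarrow>
     (\<lambda>n. SUP t\<in>T. \<integral>\<^sup>+\<omega>. ennreal ((x t \<omega> - S n t \<omega>)\<^sup>2) \<partial>M) \<longlonglongrightarrow> 0"

text \<open>The enlargement of a probability space by a sequence of independent standard Gaussian
  variables, independent of the given space. A random variable \<open>X\<close> on \<open>M\<close> is regarded as the random
  variable \<open>X \<circ> fst\<close> on the enlargement. The original space need not carry a standard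
  Gaussian variable at all (take the zero process on a one-point space), so the variables multiplied
  by a coefficient \<open>c k = 0\<close> can in general only be found on an enlargement.\<close>

definition enlargement :: "'a measure \<Rightarrow> ('a \<times> (nat \<Rightarrow> real)) measure" where
  "enlargement M = M \<Otimes>\<^sub>M (\<Pi>\<^sub>M n\<in>UNIV. std_normal_distribution)"

definition lives_on :: "'a measure \<Rightarrow> ('a \<times> 'b \<Rightarrow> real) \<Rightarrow> bool" where
  "lives_on M Z \<longleftrightarrow> (\<exists>z\<in>borel_measurable M. Z = z \<circ> fst)"

end

theory Submission
  imports Defs
begin

text \<open>The covariance operator of a stationary process with \<open>x 0 = x 1\<close> is a convolution on the circle, so it is
  diagonal in the trigonometric system: \<open>\<integral> C (s - t) trig i s ds = coef k * trig i t\<close>, where \<open>k\<close> is the frequency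
  of \<open>trig i\<close> and \<open>coef k\<close> the cosine coefficient of the covariogram \<open>C\<close> (\<open>trig_eigenfunction\<close>). Hence the
  random Fourier coefficients \<open>\<xi> i = \<integral> x t trig i t dt\<close> are uncorrelated, with variances \<open>coef k\<close>, and
  \<open>E[x t * \<xi> i] = coef k * trig i t\<close> (\<open>fourier_variables\<close>). They are mean-square limits of Riemann sums, and so
  belong to the Gaussian Hilbert space of the process.

  By Pythagoras and \<open>sin\<^sup>2 + cos\<^sup>2 = 1\<close> the partial sum up to frequency \<open>n\<close> differs from \<open>x t\<close> by a remainder of mean
  square \<open>C 0 - coef 0 - 2 (coef 1 + \<dots> + coef n)\<close>, the same for all \<open>t\<close> (\<open>mean_square_remainder\<close>,
  \<open>sum_coef_trig\<close>). It tends to 0 because the cosine series of \<open>C\<close> has nonnegative terms at 0, converges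
  uniformly by Bessel's inequality, and has sum \<open>C\<close> by completeness of the cosines (\<open>coef_sums\<close>).

  The Gaussian variables of the theorem are the \<open>\<xi> i\<close> divided by their standard deviations, and independent
  noise from the enlargement where the standard deviation is 0. Their linear combinations are Gaussian with the
  right variances, which gives the joint characteristic function. That it forces independence is derived from
  the one-dimensional uniqueness theorem of Levy by reweighting the measure
  (\<open>weighted_Levy_uniqueness\<close>, \<open>iid_std_gaussian_of_char\<close>).\<close>

section \<open>Square-integrable random variables\<close>

definition square_integrable :: "'a measure \<Rightarrow> ('a \<Rightarrow> real) \<Rightarrow> bool" where
  "square_integrable M X \<longleftrightarrow> X \<in> borel_measurable M \<and> integrable M (\<lambda>\<omega>. (X \<omega>)\<^sup>2)"

lemma square_integrable_measurable [measurable_dest]: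
  "square_integrable M X \<Longrightarrow> X \<in> borel_measurable M"
  by (simp add: square_integrable_def)

lemma square_integrable_mult:
  assumes "square_integrable M X" "square_integrable M Y"
  shows "integrable M (\<lambda>\<omega>. X \<omega> * Y \<omega>)"
proof (rule Bochner_Integration.integrable_bound)
  show "integrable M (\<lambda>\<omega>. (X \<omega>)\<^sup>2 + (Y \<omega>)\<^sup>2)" "(\<lambda>\<omega>. X \<omega> * Y \<omega>) \<in> borel_measurable M"
    using assms by (auto simp: square_integrable_def)
  show "AE \<omega> in M. norm (X \<omega> * Y \<omega>) \<le> norm ((X \<omega>)\<^sup>2 + (Y \<omega>)\<^sup>2)"
  proof (rule AE_I2)
    fix \<omega>
    have "2 * \<bar>X \<omega>\<bar> * \<bar>Y \<omega>\<bar> \<le> \<bar>X \<omega>\<bar>\<^sup>2 + \<bar>Y \<omega>\<bar>\<^sup>2" by (rule sum_squares_bound)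
    moreover have "0 \<le> \<bar>X \<omega>\<bar> * \<bar>Y \<omega>\<bar>" by simp
    ultimately show "norm (X \<omega> * Y \<omega>) \<le> norm ((X \<omega>)\<^sup>2 + (Y \<omega>)\<^sup>2)"
      unfolding real_norm_def abs_mult power2_abs by linarith
  qed
qed

lemma square_integrable_cmult:
  "square_integrable M X \<Longrightarrow> square_integrable M (\<lambda>\<omega>. c * X \<omega>)"
  by (auto simp: square_integrable_def power_mult_distrib)

lemma square_integrable_add:
  assumes "square_integrable M X" "square_integrable M Y"
  shows "square_integrable M (\<lambda>\<omega>. X \<omega> + Y \<omega>)"
  using assms square_integrable_mult[OF assms] by (auto simp: square_integrable_def power2_sum mult.assoc)

lemma square_integrable_diff:
  assumes "square_integrable M X" "square_integrable M Y"
  shows "square_integrable M (\<lambda>\<omega>. X \<omega> - Y \<omega>)"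
  using square_integrable_add[OF assms(1) square_integrable_cmult[OF assms(2), of "-1"]] by simp

lemma square_integrable_sum:
  assumes "\<And>i. i \<in> F \<Longrightarrow> square_integrable M (X i)"
  shows "square_integrable M (\<lambda>\<omega>. \<Sum>i\<in>F. X i \<omega>)"
  using assms
proof (induction F rule: infinite_finite_induct)
  case (insert i F)
  then show ?case using square_integrable_add[of M "X i"] by simp
qed (simp_all add: square_integrable_def)

definition mean_product :: "'a measure \<Rightarrow> ('a \<Rightarrow> real) \<Rightarrow> ('a \<Rightarrow> real) \<Rightarrow> real" where
  "mean_product M X Y = (\<integral>\<omega>. X \<omega> * Y \<omega> \<partial>M)"

lemma mean_product_commute: "mean_product M X Y = mean_product M Y X"
  by (simp add: mean_product_def mult.commute)

lemma mean_product_nonneg: "0 \<le> mean_product M X X"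
  by (simp add: mean_product_def)

lemma mean_product_cmult: "mean_product M X (\<lambda>\<omega>. c * Y \<omega>) = c * mean_product M X Y"
  by (simp add: mean_product_def mult.left_commute)

lemma mean_product_cmult_left: "mean_product M (\<lambda>\<omega>. c * X \<omega>) Y = c * mean_product M X Y"
  by (simp add: mean_product_def mult.assoc)

lemma mean_product_diff:
  assumes "square_integrable M X" "square_integrable M Y" "square_integrable M Z"
  shows "mean_product M X (\<lambda>\<omega>. Y \<omega> - Z \<omega>) = mean_product M X Y - mean_product M X Z"
  using assms by (simp add: mean_product_def right_diff_distrib square_integrable_mult)

lemma mean_product_sum:
  assumes "square_integrable M X" "\<And>i. i \<in> F \<Longrightarrow> square_integrable M (Y i)"
  shows "mean_product M X (\<lambda>\<omega>. \<Sum>i\<in>F. Y i \<omega>) = (\<Sum>i\<in>F. mean_product M X (Y i))"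
  using assms by (simp add: mean_product_def sum_distrib_left square_integrable_mult)

lemma mean_square_diff:
  assumes "square_integrable M X" "square_integrable M Y"
  shows "mean_product M (\<lambda>\<omega>. X \<omega> - Y \<omega>) (\<lambda>\<omega>. X \<omega> - Y \<omega>) =
    mean_product M X X - 2 * mean_product M X Y + mean_product M Y Y"
proof -
  have "mean_product M (\<lambda>\<omega>. X \<omega> - Y \<omega>) (\<lambda>\<omega>. X \<omega> - Y \<omega>) =
    mean_product M (\<lambda>\<omega>. X \<omega> - Y \<omega>) X - mean_product M (\<lambda>\<omega>. X \<omega> - Y \<omega>) Y"
    using assms by (intro mean_product_diff square_integrable_diff)
  then show ?thesis
    using assms by (simp add: mean_product_commute[of M "\<lambda>\<omega>. X \<omega> - Y \<omega>" X] mean_product_commute[of M "\<lambda>\<omega>. X \<omega> - Y \<omega>" Y]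
        mean_product_diff mean_product_commute[of M Y X])
qed

lemma nn_integral_square:
  assumes "square_integrable M X"
  shows "(\<integral>\<^sup>+\<omega>. ennreal ((X \<omega>)\<^sup>2) \<partial>M) = ennreal (mean_product M X X)"
  using assms unfolding mean_product_def power2_eq_square[symmetric]
  by (intro nn_integral_eq_integral) (auto simp: square_integrable_def)

text \<open>The quadratic \<open>t \<mapsto> E[(X - t Y)\<^sup>2]\<close> is nonnegative; its value at the minimum \<open>t = E[X Y] / E[Y\<^sup>2]\<close> is the
  inequality. If \<open>E[Y\<^sup>2] = 0\<close> it is an affine function of \<open>t\<close>, so its slope vanishes.\<close>

lemma mean_product_Cauchy_Schwarz:
  assumes "square_integrable M X" "square_integrable M Y"
  shows "(mean_product M X Y)\<^sup>2 \<le> mean_product M X X * mean_product M Y Y"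
proof -
  define a b c where "a = mean_product M X X" "b = mean_product M X Y" "c = mean_product M Y Y"
  have q: "0 \<le> a - 2 * t * b + t\<^sup>2 * c" for t
  proof -
    have "0 \<le> mean_product M (\<lambda>\<omega>. X \<omega> - t * Y \<omega>) (\<lambda>\<omega>. X \<omega> - t * Y \<omega>)" by (rule mean_product_nonneg)
    also have "\<dots> = a - 2 * t * b + t\<^sup>2 * c"
      using assms by (simp add: mean_square_diff square_integrable_cmult mean_product_cmult
        mean_product_cmult_left a_b_c_def power2_eq_square)
    finally show ?thesis .
  qed
  have c: "0 \<le> c" and a: "0 \<le> a" by (auto simp: a_b_c_def mean_product_nonneg)
  have "b\<^sup>2 \<le> a * c"
  proof (cases "c = 0")
    case True
    have "b = 0"
    proof (rule ccontr)
      assume "b \<noteq> 0"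
      with q[of "(a + 1) / (2 * b)"] True show False by simp
    qed
    then show ?thesis using True by simp
  next
    case False
    then have "0 \<le> c * (a - 2 * (b / c) * b + (b / c)\<^sup>2 * c)" using q[of "b / c"] c by simp
    also have "\<dots> = a * c - b\<^sup>2" using False by (simp add: field_simps power2_eq_square)
    finally show ?thesis by simp
  qed
  then show ?thesis by (simp add: a_b_c_def)
qed

lemma (in prob_space) square_integrable_integrable:
  assumes "square_integrable M X"
  shows "integrable M X"
  using square_integrable_mult[OF assms, of "\<lambda>_. 1"] by (simp add: square_integrable_def)

lemma (in prob_space) mean_abs_le:
  assumes X: "square_integrable M X"
  shows "(\<integral>\<omega>. \<bar>X \<omega>\<bar> \<partial>M) \<le> sqrt (mean_product M X X)"
proof -
  have "square_integrable M (\<lambda>\<omega>. \<bar>X \<omega>\<bar>)" "square_integrable M (\<lambda>\<omega>. 1)"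
    using X by (auto simp: square_integrable_def)
  from mean_product_Cauchy_Schwarz[OF this]
  have "(\<integral>\<omega>. \<bar>X \<omega>\<bar> \<partial>M)\<^sup>2 \<le> mean_product M X X"
    by (simp add: mean_product_def prob_space)
  then show ?thesis by (rule real_le_rsqrt)
qed

definition ms_limit :: "'a measure \<Rightarrow> (nat \<Rightarrow> 'a \<Rightarrow> real) \<Rightarrow> ('a \<Rightarrow> real) \<Rightarrow> bool" where
  "ms_limit M X Y \<longleftrightarrow> (\<lambda>n. mean_product M (\<lambda>\<omega>. X n \<omega> - Y \<omega>) (\<lambda>\<omega>. X n \<omega> - Y \<omega>)) \<longlonglongrightarrow> 0"

lemma mean_product_tendsto_ms_limit:
  assumes Z: "square_integrable M Z" and X: "\<And>n. square_integrable M (X n)" and Y: "square_integrable M Y"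
    and "ms_limit M X Y"
  shows "(\<lambda>n. mean_product M Z (X n)) \<longlonglongrightarrow> mean_product M Z Y"
proof -
  define d where "d n = mean_product M (\<lambda>\<omega>. X n \<omega> - Y \<omega>) (\<lambda>\<omega>. X n \<omega> - Y \<omega>)" for n
  have lim: "(\<lambda>n. sqrt (mean_product M Z Z * d n)) \<longlonglongrightarrow> sqrt (mean_product M Z Z * 0)"
    using assms(4) unfolding ms_limit_def d_def by (intro tendsto_intros)
  have bound: "\<bar>mean_product M Z (X n) - mean_product M Z Y\<bar> \<le> sqrt (mean_product M Z Z * d n)" for n
    using mean_product_Cauchy_Schwarz[OF Z square_integrable_diff[OF X Y], of n]
    by (intro real_le_rsqrt) (simp add: mean_product_diff[OF Z X Y] d_def)
  have "(\<lambda>n. mean_product M Z (X n) - mean_product M Z Y) \<longlonglongrightarrow> 0"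
  proof (rule Lim_null_comparison)
    show "\<forall>\<^sub>F n in sequentially. norm (mean_product M Z (X n) - mean_product M Z Y) \<le> sqrt (mean_product M Z Z * d n)"
      using bound by simp
    show "(\<lambda>n. sqrt (mean_product M Z Z * d n)) \<longlonglongrightarrow> 0" using lim by simp
  qed
  then show ?thesis by (simp add: LIM_zero_iff)
qed

text \<open>Riesz--Fischer. A sequence that is Cauchy in mean square is Cauchy in \<open>L\<^sup>1\<close>, hence has an almost surely
  convergent subsequence; Fatou's lemma then turns the Cauchy estimate \<open>E[(X m - X n)\<^sup>2] < e\<close> into an estimate
  for the distance to the pointwise limit.\<close>

lemma (in prob_space) square_integrable_complete:
  assumes X: "\<And>n. square_integrable M (X n)"
    and Cauchy: "\<And>e. e > 0 \<Longrightarrow> \<exists>N. \<forall>m\<ge>N. \<forall>n\<ge>N.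
      mean_product M (\<lambda>\<omega>. X m \<omega> - X n \<omega>) (\<lambda>\<omega>. X m \<omega> - X n \<omega>) < e"
  obtains Y where "square_integrable M Y" "ms_limit M X Y"
proof -
  let ?d = "\<lambda>m n. mean_product M (\<lambda>\<omega>. X m \<omega> - X n \<omega>) (\<lambda>\<omega>. X m \<omega> - X n \<omega>)"
  note [measurable] = X
  have L1: "\<exists>N. \<forall>i\<ge>N. \<forall>j\<ge>N. (\<integral>\<omega>. norm (X i \<omega> - X j \<omega>) \<partial>M) < e" if "e > 0" for e
  proof -
    obtain N where N: "\<And>m n. m \<ge> N \<Longrightarrow> n \<ge> N \<Longrightarrow> ?d m n < e\<^sup>2"
      using Cauchy[of "e\<^sup>2"] \<open>e > 0\<close> zero_less_power[of e 2] by blast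
    have "(\<integral>\<omega>. norm (X i \<omega> - X j \<omega>) \<partial>M) < e" if "i \<ge> N" "j \<ge> N" for i j
    proof -
      have "(\<integral>\<omega>. norm (X i \<omega> - X j \<omega>) \<partial>M) \<le> sqrt (?d i j)"
        using mean_abs_le[OF square_integrable_diff[OF X X]] by simp
      also have "\<dots> < sqrt (e\<^sup>2)" using N that by (intro real_sqrt_less_mono)
      finally show ?thesis using \<open>e > 0\<close> by simp
    qed
    then show ?thesis by auto
  qed
  obtain r where r: "strict_mono r" "AE \<omega> in M. Cauchy (\<lambda>i. X (r i) \<omega>)"
    by (rule cauchy_L1_AE_cauchy_subseq[OF square_integrable_integrable[OF X] L1])
  define Y where "Y \<omega> = lim (\<lambda>i. X (r i) \<omega>)" for \<omega>
  have [measurable]: "Y \<in> borel_measurable M" unfolding Y_def by measurable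
  have lim: "AE \<omega> in M. (\<lambda>i. X (r i) \<omega>) \<longlonglongrightarrow> Y \<omega>"
    using r(2) by eventually_elim (simp add: Y_def Cauchy_convergent_iff convergent_LIMSEQ_iff)
  \<comment> \<open>The mean squares are taken in the extended reals, since square integrability of the limit is only a consequence of this bound.\<close>
  have Fatou: "\<exists>N. \<forall>m\<ge>N. (\<integral>\<^sup>+\<omega>. ennreal ((X m \<omega> - Y \<omega>)\<^sup>2) \<partial>M) \<le> ennreal e" if "e > 0" for e
  proof -
    obtain N where N: "\<And>m n. m \<ge> N \<Longrightarrow> n \<ge> N \<Longrightarrow> ?d m n < e"
      using Cauchy[of e] \<open>e > 0\<close> by auto
    have "(\<integral>\<^sup>+\<omega>. ennreal ((X m \<omega> - Y \<omega>)\<^sup>2) \<partial>M) \<le> ennreal e" if "m \<ge> N" for m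
    proof -
      have "(\<integral>\<^sup>+\<omega>. ennreal ((X m \<omega> - Y \<omega>)\<^sup>2) \<partial>M) =
          (\<integral>\<^sup>+\<omega>. liminf (\<lambda>i. ennreal ((X m \<omega> - X (r i) \<omega>)\<^sup>2)) \<partial>M)"
      proof (rule nn_integral_cong_AE, use lim in eventually_elim)
        case (elim \<omega>)
        then have "(\<lambda>i. ennreal ((X m \<omega> - X (r i) \<omega>)\<^sup>2)) \<longlonglongrightarrow> ennreal ((X m \<omega> - Y \<omega>)\<^sup>2)"
          by (intro tendsto_ennrealI tendsto_intros)
        from lim_imp_Liminf[OF sequentially_bot this] show ?case by simp
      qed
      also have "\<dots> \<le> liminf (\<lambda>i. \<integral>\<^sup>+\<omega>. ennreal ((X m \<omega> - X (r i) \<omega>)\<^sup>2) \<partial>M)"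
        by (rule nn_integral_liminf) measurable
      also have "\<dots> \<le> ennreal e"
      proof (rule Liminf_le, simp)
        have "(\<integral>\<^sup>+\<omega>. ennreal ((X m \<omega> - X (r i) \<omega>)\<^sup>2) \<partial>M) \<le> ennreal e" if "i \<ge> N" for i
        proof -
          have "r i \<ge> N" using seq_suble[OF r(1), of i] that by simp
          then show ?thesis
            using N[OF \<open>m \<ge> N\<close>, of "r i"] by (subst nn_integral_square[OF square_integrable_diff[OF X X]]) (simp add: ennreal_leI)
        qed
        then show "\<forall>\<^sub>F i in sequentially. (\<integral>\<^sup>+\<omega>. ennreal ((X m \<omega> - X (r i) \<omega>)\<^sup>2) \<partial>M) \<le> ennreal e"
          using eventually_sequentially by auto
      qed
      finally show ?thesis .
    qed
    then show ?thesis by auto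
  qed
  have Ysq: "square_integrable M Y"
  proof -
    obtain N where "(\<integral>\<^sup>+\<omega>. ennreal ((X N \<omega> - Y \<omega>)\<^sup>2) \<partial>M) \<le> ennreal 1" using Fatou[of 1] by auto
    then have "square_integrable M (\<lambda>\<omega>. X N \<omega> - Y \<omega>)"
      unfolding square_integrable_def
      by (intro conjI integrableI_bounded) (auto simp: le_less_trans[OF _ ennreal_one_less_top])
    from square_integrable_diff[OF X[of N] this] show ?thesis by simp
  qed
  moreover have "ms_limit M X Y"
    unfolding ms_limit_def
  proof (rule LIMSEQ_I)
    fix e :: real assume "e > 0"
    then obtain N where N: "\<And>m. m \<ge> N \<Longrightarrow> (\<integral>\<^sup>+\<omega>. ennreal ((X m \<omega> - Y \<omega>)\<^sup>2) \<partial>M) \<le> ennreal (e / 2)"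
      using Fatou[of "e / 2"] by auto
    have "mean_product M (\<lambda>\<omega>. X m \<omega> - Y \<omega>) (\<lambda>\<omega>. X m \<omega> - Y \<omega>) \<le> e / 2" if "m \<ge> N" for m
      using N[OF that] \<open>e > 0\<close> nn_integral_square[OF square_integrable_diff[OF X Ysq], of m]
      by (simp add: mean_product_nonneg)
    then have "norm (mean_product M (\<lambda>\<omega>. X m \<omega> - Y \<omega>) (\<lambda>\<omega>. X m \<omega> - Y \<omega>) - 0) < e" if "m \<ge> N" for m
      unfolding diff_zero real_norm_def abs_of_nonneg[OF mean_product_nonneg] using that \<open>e > 0\<close> by fastforce
    then show "\<exists>N. \<forall>m\<ge>N. norm (mean_product M (\<lambda>\<omega>. X m \<omega> - Y \<omega>) (\<lambda>\<omega>. X m \<omega> - Y \<omega>) - 0) < e"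
      by blast
  qed
  ultimately show ?thesis by (rule that)
qed

lemma ms_limit_cmult:
  assumes "ms_limit M X Y" shows "ms_limit M (\<lambda>n \<omega>. c * X n \<omega>) (\<lambda>\<omega>. c * Y \<omega>)"
  using tendsto_mult_left[OF assms[unfolded ms_limit_def], of "c\<^sup>2"]
  unfolding ms_limit_def right_diff_distrib[symmetric] mean_product_cmult mean_product_cmult_left
  by (simp add: power2_eq_square mult.assoc)

lemma ms_limit_add:
  assumes sq: "\<And>n. square_integrable M (X n)" "square_integrable M Y" "\<And>n. square_integrable M (X' n)" "square_integrable M Y'"
    and lim: "ms_limit M X Y" "ms_limit M X' Y'"
  shows "ms_limit M (\<lambda>n \<omega>. X n \<omega> + X' n \<omega>) (\<lambda>\<omega>. Y \<omega> + Y' \<omega>)"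
  unfolding ms_limit_def
proof (rule Lim_null_comparison)
  let ?d = "\<lambda>n \<omega>. X n \<omega> - Y \<omega>" and ?d' = "\<lambda>n \<omega>. X' n \<omega> - Y' \<omega>"
  have d: "square_integrable M (?d n)" "square_integrable M (?d' n)" for n
    by (intro square_integrable_diff sq)+
  have "mean_product M (\<lambda>\<omega>. X n \<omega> + X' n \<omega> - (Y \<omega> + Y' \<omega>)) (\<lambda>\<omega>. X n \<omega> + X' n \<omega> - (Y \<omega> + Y' \<omega>))
      \<le> 2 * mean_product M (?d n) (?d n) + 2 * mean_product M (?d' n) (?d' n)" for n
  proof -
    have "square_integrable M (\<lambda>\<omega>. ?d n \<omega> + ?d' n \<omega>)" by (intro square_integrable_add d)
    moreover have "(?d n \<omega> + ?d' n \<omega>) * (?d n \<omega> + ?d' n \<omega>) \<le> 2 * (?d n \<omega> * ?d n \<omega>) + 2 * (?d' n \<omega> * ?d' n \<omega>)" for \<omega>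
      using zero_le_square[of "?d n \<omega> - ?d' n \<omega>"] by (simp add: algebra_simps)
    ultimately have "mean_product M (\<lambda>\<omega>. ?d n \<omega> + ?d' n \<omega>) (\<lambda>\<omega>. ?d n \<omega> + ?d' n \<omega>) \<le>
        (\<integral>\<omega>. 2 * (?d n \<omega> * ?d n \<omega>) + 2 * (?d' n \<omega> * ?d' n \<omega>) \<partial>M)"
      unfolding mean_product_def using d
      by (intro integral_mono Bochner_Integration.integrable_add integrable_mult_right square_integrable_mult)
    also have "\<dots> = 2 * mean_product M (?d n) (?d n) + 2 * mean_product M (?d' n) (?d' n)"
      unfolding mean_product_def using d by (simp add: square_integrable_mult)
    finally show ?thesis by (simp add: algebra_simps)
  qed
  then show "\<forall>\<^sub>F n in sequentially. norm (mean_product M (\<lambda>\<omega>. X n \<omega> + X' n \<omega> - (Y \<omega> + Y' \<omega>)) (\<lambda>\<omega>. X n \<omega> + X' n \<omega> - (Y \<omega> + Y' \<omega>)))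
      \<le> 2 * mean_product M (?d n) (?d n) + 2 * mean_product M (?d' n) (?d' n)"
    unfolding real_norm_def abs_of_nonneg[OF mean_product_nonneg] by simp
  show "(\<lambda>n. 2 * mean_product M (?d n) (?d n) + 2 * mean_product M (?d' n) (?d' n)) \<longlonglongrightarrow> 0"
    using tendsto_add[OF tendsto_mult_left[OF lim(1)[unfolded ms_limit_def], of 2]
      tendsto_mult_left[OF lim(2)[unfolded ms_limit_def], of 2]] by simp
qed

lemma mean_square_ms_limit:
  assumes X: "\<And>n. square_integrable M (X n)" and Y: "square_integrable M Y" and lim: "ms_limit M X Y"
  shows "(\<lambda>n. mean_product M (X n) (X n)) \<longlonglongrightarrow> mean_product M Y Y"
proof -
  have "(\<lambda>n. mean_product M (\<lambda>\<omega>. X n \<omega> - Y \<omega>) (\<lambda>\<omega>. X n \<omega> - Y \<omega>) + 2 * mean_product M Y (X n) - mean_product M Y Y)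
      \<longlonglongrightarrow> 0 + 2 * mean_product M Y Y - mean_product M Y Y"
    using lim unfolding ms_limit_def
    by (intro tendsto_intros mean_product_tendsto_ms_limit[OF Y X Y lim])
  moreover have "mean_product M (\<lambda>\<omega>. X n \<omega> - Y \<omega>) (\<lambda>\<omega>. X n \<omega> - Y \<omega>) + 2 * mean_product M Y (X n) - mean_product M Y Y
      = mean_product M (X n) (X n)" for n
    by (simp add: mean_square_diff X Y mean_product_commute[of M Y "X n"])
  ultimately show ?thesis by simp
qed

text \<open>Mean-square convergence passes to characteristic functions because \<open>v \<mapsto> exp (i v)\<close> is 1-Lipschitz and
  the \<open>L\<^sup>1\<close> norm is bounded by the \<open>L\<^sup>2\<close> norm. This is what makes a mean-square limit of Gaussian variables
  Gaussian.\<close>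

lemma (in prob_space) iexp_ms_limit:
  assumes X: "\<And>n. square_integrable M (X n)" and Y: "square_integrable M Y" and lim: "ms_limit M X Y"
  shows "(\<lambda>n. \<integral>\<omega>. iexp (X n \<omega>) \<partial>M) \<longlonglongrightarrow> (\<integral>\<omega>. iexp (Y \<omega>) \<partial>M)"
proof -
  note [measurable] = X Y
  have int: "complex_integrable M (\<lambda>\<omega>. iexp (Z \<omega>))" if "Z \<in> borel_measurable M" for Z :: "'a \<Rightarrow> real"
    by (rule integrable_const_bound[where B=1]) (use that in auto)
  have iexp_diff: "norm (iexp a - iexp b) \<le> \<bar>a - b\<bar>" for a b :: real
  proof -
    have "iexp a - iexp b = iexp b * (iexp (a - b) - 1)"
      by (simp add: right_diff_distrib exp_add[symmetric])
    then have "norm (iexp a - iexp b) = norm (iexp (a - b) - 1)" by (simp add: norm_mult)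
    also have "\<dots> \<le> \<bar>a - b\<bar>" using iexp_approx1[of "a - b" 0] by simp
    finally show ?thesis .
  qed
  let ?d = "\<lambda>n. mean_product M (\<lambda>\<omega>. X n \<omega> - Y \<omega>) (\<lambda>\<omega>. X n \<omega> - Y \<omega>)"
  have bound: "norm ((\<integral>\<omega>. iexp (X n \<omega>) \<partial>M) - (\<integral>\<omega>. iexp (Y \<omega>) \<partial>M)) \<le> sqrt (?d n)" for n
  proof -
    have "norm ((\<integral>\<omega>. iexp (X n \<omega>) \<partial>M) - (\<integral>\<omega>. iexp (Y \<omega>) \<partial>M)) = norm (\<integral>\<omega>. iexp (X n \<omega>) - iexp (Y \<omega>) \<partial>M)"
      by (subst Bochner_Integration.integral_diff) (auto intro!: int)
    also have "\<dots> \<le> (\<integral>\<omega>. norm (iexp (X n \<omega>) - iexp (Y \<omega>)) \<partial>M)" by (rule integral_norm_bound)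
    also have "\<dots> \<le> (\<integral>\<omega>. \<bar>X n \<omega> - Y \<omega>\<bar> \<partial>M)"
      by (intro integral_mono integrable_norm Bochner_Integration.integrable_diff int iexp_diff integrable_abs
          square_integrable_integrable X Y) measurable
    also have "\<dots> \<le> sqrt (?d n)" by (rule mean_abs_le[OF square_integrable_diff[OF X Y]])
    finally show ?thesis .
  qed
  have "(\<lambda>n. sqrt (?d n)) \<longlonglongrightarrow> 0"
    using tendsto_real_sqrt[OF lim[unfolded ms_limit_def]] by simp
  then have "(\<lambda>n. (\<integral>\<omega>. iexp (X n \<omega>) \<partial>M) - (\<integral>\<omega>. iexp (Y \<omega>) \<partial>M)) \<longlonglongrightarrow> 0"
    by (rule Lim_null_comparison[OF always_eventually[OF allI[OF bound]]])
  then show ?thesis by (simp add: LIM_zero_iff)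
qed

section \<open>Independence from the joint characteristic function\<close>

lemma (in prob_space) integrable_bounded_complex:
  fixes f :: "'a \<Rightarrow> complex"
  assumes "f \<in> borel_measurable M" "\<And>\<omega>. norm (f \<omega>) \<le> K"
  shows "integrable M f"
  by (rule integrable_const_bound[where B=K]) (use assms in auto)

text \<open>The factorization hypothesis says that \<open>V\<close> has the same characteristic function under \<open>M\<close> and under the
  measure with density \<open>W / E[W]\<close>. By Levy's uniqueness theorem it has the same law under both, which is the
  claim. So the one-dimensional uniqueness theorem is enough to decouple one variable from a whole vector.\<close>

lemma (in prob_space) weighted_Levy_uniqueness_nonneg:
  fixes W V :: "'a \<Rightarrow> real"
  assumes [measurable]: "W \<in> borel_measurable M" "V \<in> borel_measurable M" "B \<in> sets borel"
    and W: "\<And>\<omega>. 0 \<le> W \<omega>" "\<And>\<omega>. W \<omega> \<le> K"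
    and char: "\<And>t. (\<integral>\<omega>. W \<omega> * iexp (t * V \<omega>) \<partial>M) = (\<integral>\<omega>. W \<omega> \<partial>M) * (\<integral>\<omega>. iexp (t * V \<omega>) \<partial>M)"
  shows "(\<integral>\<omega>. W \<omega> * indicator B (V \<omega>) \<partial>M) = (\<integral>\<omega>. W \<omega> \<partial>M) * (\<integral>\<omega>. indicator B (V \<omega>) \<partial>M)"
proof -
  define w where "w = (\<integral>\<omega>. W \<omega> \<partial>M)"
  have intW: "integrable M W"
    by (rule integrable_const_bound[where B=K]) (use W in auto)
  have w0: "0 \<le> w" unfolding w_def using W by (intro integral_nonneg_AE) auto
  show ?thesis
  proof (cases "w = 0")
    case True
    then have "AE \<omega> in M. W \<omega> = 0"
      unfolding w_def using intW W by (subst (asm) integral_nonneg_eq_0_iff_AE) auto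
    then have "(\<integral>\<omega>. W \<omega> * indicator B (V \<omega>) \<partial>M) = (\<integral>\<omega>. 0 \<partial>M)"
      by (intro integral_cong_AE) auto
    with True show ?thesis by (simp add: w_def)
  next
    case False
    define N where "N = density M (\<lambda>\<omega>. ennreal (W \<omega> / w))"
    have N: "(\<integral>\<omega>. f \<omega> \<partial>N) = (\<integral>\<omega>. (W \<omega> / w) *\<^sub>R f \<omega> \<partial>M)"
      if "f \<in> borel_measurable M" for f :: "'a \<Rightarrow> 'b :: {banach, second_countable_topology}"
      unfolding N_def by (rule integral_density) (use that W w0 in auto)
    have "(\<integral>\<^sup>+\<omega>. ennreal (W \<omega> / w) \<partial>M) = ennreal (\<integral>\<omega>. W \<omega> / w \<partial>M)"
      using intW W w0 by (intro nn_integral_eq_integral) auto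
    also have "(\<integral>\<omega>. W \<omega> / w \<partial>M) = 1" using False by (simp add: w_def)
    finally have "prob_space N"
      unfolding N_def by (intro prob_spaceI) (simp add: emeasure_density cong: nn_integral_cong)
    then interpret N: prob_space N .
    have [measurable]: "V \<in> borel_measurable N" by (simp add: N_def)
    have "char (distr N borel V) t = char (distr M borel V) t" for t
    proof -
      have "char (distr N borel V) t = (\<integral>\<omega>. (W \<omega> / w) *\<^sub>R iexp (t * V \<omega>) \<partial>M)"
        unfolding char_def by (subst integral_distr) (auto intro!: N)
      also have "\<dots> = (\<integral>\<omega>. W \<omega> * iexp (t * V \<omega>) \<partial>M) / w"
        by (simp add: scaleR_conv_of_real)
      also have "\<dots> = (\<integral>\<omega>. iexp (t * V \<omega>) \<partial>M)"
        using False by (subst char) (simp add: w_def)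
      finally show ?thesis by (simp add: char_def integral_distr)
    qed
    then have eq: "distr N borel V = distr M borel V"
      by (intro Levy_uniqueness) auto
    have "(\<integral>\<omega>. W \<omega> * indicator B (V \<omega>) \<partial>M) / w = (\<integral>\<omega>. indicator B (V \<omega>) \<partial>N)"
      by (subst N) auto
    also have "\<dots> = (\<integral>v. indicator B v \<partial>distr N borel V)" by (subst integral_distr) auto
    also have "\<dots> = (\<integral>\<omega>. indicator B (V \<omega>) \<partial>M)" unfolding eq by (subst integral_distr) auto
    finally show ?thesis using False by (simp add: w_def field_simps)
  qed
qed

text \<open>Hypothesis and conclusion are affine in the weight and hold for constant weights, so a bounded weight may be
  shifted to a nonnegative one.\<close>

lemma (in prob_space) weighted_Levy_uniqueness_real:
  fixes W V :: "'a \<Rightarrow> real"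
  assumes [measurable]: "W \<in> borel_measurable M" "V \<in> borel_measurable M" "B \<in> sets borel"
    and W: "\<And>\<omega>. \<bar>W \<omega>\<bar> \<le> K"
    and char: "\<And>t. (\<integral>\<omega>. W \<omega> * iexp (t * V \<omega>) \<partial>M) = (\<integral>\<omega>. W \<omega> \<partial>M) * (\<integral>\<omega>. iexp (t * V \<omega>) \<partial>M)"
  shows "(\<integral>\<omega>. W \<omega> * indicator B (V \<omega>) \<partial>M) = (\<integral>\<omega>. W \<omega> \<partial>M) * (\<integral>\<omega>. indicator B (V \<omega>) \<partial>M)"
proof -
  have intW: "integrable M W"
    by (rule integrable_const_bound[where B=K]) (use W in auto)
  have intWe: "integrable M (\<lambda>\<omega>. W \<omega> * iexp (t * V \<omega>))" for t
    by (rule integrable_bounded_complex[where K=K]) (use W in \<open>auto simp: norm_mult\<close>)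
  have inte: "integrable M (\<lambda>\<omega>. iexp (t * V \<omega>))" for t
    by (rule integrable_bounded_complex[where K=1]) auto
  have inti: "integrable M (\<lambda>\<omega>. indicator B (V \<omega>) :: real)"
    by (rule integrable_const_bound[where B=1]) auto
  have intWi: "integrable M (\<lambda>\<omega>. W \<omega> * indicator B (V \<omega>))"
    by (rule integrable_const_bound[where B=K]) (use W in \<open>auto simp: abs_mult indicator_def intro: order_trans[OF abs_ge_zero W]\<close>)
  have "(\<integral>\<omega>. (W \<omega> + K) * indicator B (V \<omega>) \<partial>M) = (\<integral>\<omega>. W \<omega> + K \<partial>M) * (\<integral>\<omega>. indicator B (V \<omega>) \<partial>M)"
  proof (rule weighted_Levy_uniqueness_nonneg[where K="2 * K"])
    fix \<omega> show "0 \<le> W \<omega> + K" "W \<omega> + K \<le> 2 * K" using W[of \<omega>] by auto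
  next
    fix t
    show "(\<integral>\<omega>. complex_of_real (W \<omega> + K) * iexp (t * V \<omega>) \<partial>M) =
       complex_of_real (\<integral>\<omega>. W \<omega> + K \<partial>M) * (\<integral>\<omega>. iexp (t * V \<omega>) \<partial>M)"
      using intWe[of t] inte[of t] intW char[of t] by (simp add: distrib_right prob_space)
  qed auto
  then show ?thesis using intW inti intWi by (simp add: distrib_right prob_space)
qed

text \<open>The hypothesis for \<open>W\<close> at \<open>- t\<close>, conjugated, is the hypothesis for the conjugate of \<open>W\<close> at \<open>t\<close>; hence it
  holds for the real and imaginary parts of \<open>W\<close>.\<close>

lemma (in prob_space) weighted_Levy_uniqueness:
  fixes W :: "'a \<Rightarrow> complex" and V :: "'a \<Rightarrow> real"
  assumes [measurable]: "W \<in> borel_measurable M" "V \<in> borel_measurable M" "B \<in> sets borel"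
    and W: "\<And>\<omega>. norm (W \<omega>) \<le> K"
    and char: "\<And>t. (\<integral>\<omega>. W \<omega> * iexp (t * V \<omega>) \<partial>M) = (\<integral>\<omega>. W \<omega> \<partial>M) * (\<integral>\<omega>. iexp (t * V \<omega>) \<partial>M)"
  shows "(\<integral>\<omega>. W \<omega> * indicator B (V \<omega>) \<partial>M) = (\<integral>\<omega>. W \<omega> \<partial>M) * (\<integral>\<omega>. indicator B (V \<omega>) \<partial>M)"
proof -
  have intW: "integrable M W" using W by (intro integrable_bounded_complex[where K=K]) auto
  have intWe: "integrable M (\<lambda>\<omega>. W \<omega> * iexp (t * V \<omega>))" for t
    by (rule integrable_bounded_complex[where K=K]) (use W in \<open>auto simp: norm_mult\<close>)
  have intWi: "integrable M (\<lambda>\<omega>. W \<omega> * indicator B (V \<omega>))"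
    by (rule integrable_bounded_complex[where K=K])
       (use W in \<open>auto simp: norm_mult indicator_def intro: order_trans[OF norm_ge_zero W]\<close>)
  have cnj_char: "(\<integral>\<omega>. cnj (W \<omega>) * iexp (t * V \<omega>) \<partial>M) = cnj (\<integral>\<omega>. W \<omega> \<partial>M) * (\<integral>\<omega>. iexp (t * V \<omega>) \<partial>M)" for t
  proof -
    have "(\<integral>\<omega>. cnj (W \<omega>) * iexp (t * V \<omega>) \<partial>M) = (\<integral>\<omega>. cnj (W \<omega> * iexp (- t * V \<omega>)) \<partial>M)"
      by (simp add: exp_cnj)
    also have "\<dots> = cnj ((\<integral>\<omega>. W \<omega> \<partial>M) * (\<integral>\<omega>. iexp (- t * V \<omega>) \<partial>M))"
      by (simp only: Bochner_Integration.integral_cnj char)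
    also have "\<dots> = cnj (\<integral>\<omega>. W \<omega> \<partial>M) * (\<integral>\<omega>. cnj (iexp (- t * V \<omega>)) \<partial>M)"
      by (simp only: Bochner_Integration.integral_cnj complex_cnj_mult)
    finally show ?thesis by (simp add: exp_cnj)
  qed
  have [measurable]: "(\<lambda>\<omega>. cnj (W \<omega>)) \<in> borel_measurable M"
    by (rule measurable_compose[OF _ borel_measurable_continuous_onI]) (auto intro: continuous_intros)
  have intCe: "integrable M (\<lambda>\<omega>. cnj (W \<omega>) * iexp (t * V \<omega>))" for t
    by (rule integrable_bounded_complex[where K=K]) (use W in \<open>auto simp: norm_mult\<close>)
  have Re: "of_real (Re z) = (z + cnj z) / 2" and Im: "of_real (Im z) = \<i> / 2 * cnj z - \<i> / 2 * z" for z
    by (auto simp: complex_eq_iff)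
  have re: "(\<integral>\<omega>. Re (W \<omega>) * indicator B (V \<omega>) \<partial>M) = (\<integral>\<omega>. Re (W \<omega>) \<partial>M) * (\<integral>\<omega>. indicator B (V \<omega>) \<partial>M)"
  proof (rule weighted_Levy_uniqueness_real[where K=K])
    fix \<omega> show "\<bar>Re (W \<omega>)\<bar> \<le> K" using W[of \<omega>] abs_Re_le_cmod order_trans by blast
  next
    fix t
    show "(\<integral>\<omega>. complex_of_real (Re (W \<omega>)) * iexp (t * V \<omega>) \<partial>M) =
       complex_of_real (\<integral>\<omega>. Re (W \<omega>) \<partial>M) * (\<integral>\<omega>. iexp (t * V \<omega>) \<partial>M)"
      using intWe[of t] intCe[of t] intW char[of t] cnj_char[of t]
      by (simp add: Re distrib_right add_divide_distrib integral_Re[OF intW])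
  qed auto
  have im: "(\<integral>\<omega>. Im (W \<omega>) * indicator B (V \<omega>) \<partial>M) = (\<integral>\<omega>. Im (W \<omega>) \<partial>M) * (\<integral>\<omega>. indicator B (V \<omega>) \<partial>M)"
  proof (rule weighted_Levy_uniqueness_real[where K=K])
    fix \<omega> show "\<bar>Im (W \<omega>)\<bar> \<le> K" using W[of \<omega>] abs_Im_le_cmod order_trans by blast
  next
    fix t
    show "(\<integral>\<omega>. complex_of_real (Im (W \<omega>)) * iexp (t * V \<omega>) \<partial>M) =
       complex_of_real (\<integral>\<omega>. Im (W \<omega>) \<partial>M) * (\<integral>\<omega>. iexp (t * V \<omega>) \<partial>M)"
      using intWe[of t] intCe[of t] intW char[of t] cnj_char[of t]
      by (simp add: Im left_diff_distrib mult.assoc integral_Im[OF intW])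
  qed auto
  have ind: "(indicator B v :: complex) = of_real (indicator B v)" for v :: real
    by (simp add: indicator_def)
  have "Re (\<integral>\<omega>. W \<omega> * indicator B (V \<omega>) \<partial>M) = (\<integral>\<omega>. Re (W \<omega>) * indicator B (V \<omega>) \<partial>M)"
    using integral_Re[OF intWi] by (simp add: ind)
  moreover have "Im (\<integral>\<omega>. W \<omega> * indicator B (V \<omega>) \<partial>M) = (\<integral>\<omega>. Im (W \<omega>) * indicator B (V \<omega>) \<partial>M)"
    using integral_Im[OF intWi] by (simp add: ind)
  ultimately show ?thesis
    by (simp add: complex_eq_iff re im ind integral_Re[OF intW] integral_Im[OF intW])
qed

text \<open>Indicators are exchanged for exponentials one index at a time. The part of the product that belongs to
  the other indices serves as the complex weight of \<open>weighted_Levy_uniqueness\<close>, and the induction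
  hypothesis, applied to one more exponential, is the factorization that \<open>weighted_Levy_uniqueness\<close> requires.\<close>

lemma (in prob_space) mixed_char_factorization:
  fixes Z :: "'i \<Rightarrow> 'a \<Rightarrow> real"
  assumes [measurable]: "\<And>i. Z i \<in> borel_measurable M" and B [measurable]: "\<And>i. B i \<in> sets borel"
    and char: "\<And>F s. finite F \<Longrightarrow> (\<integral>\<omega>. iexp (\<Sum>i\<in>F. s i * Z i \<omega>) \<partial>M) = of_real (exp (- (\<Sum>i\<in>F. (s i)\<^sup>2) / 2))"
    and "finite A" "finite F" "A \<inter> F = {}"
  shows "(\<integral>\<omega>. (\<Prod>i\<in>A. indicator (B i) (Z i \<omega>)) * iexp (\<Sum>i\<in>F. s i * Z i \<omega>) \<partial>M) =
    (\<Prod>i\<in>A. \<integral>\<omega>. indicator (B i) (Z i \<omega>) \<partial>M) * of_real (exp (- (\<Sum>i\<in>F. (s i)\<^sup>2) / 2))"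
  using assms(4-6)
proof (induction A arbitrary: F s rule: finite_induct)
  case empty
  then show ?case by (simp add: char del: of_real_sum of_real_exp)
next
  case (insert a A)
  define W where "W \<omega> = (\<Prod>i\<in>A. indicator (B i) (Z i \<omega>)) * iexp (\<Sum>i\<in>F. s i * Z i \<omega>)" for \<omega>
  have [measurable]: "W \<in> borel_measurable M" unfolding W_def by measurable
  have normW: "norm (W \<omega>) \<le> 1" for \<omega>
    unfolding W_def norm_mult by (simp add: prod_norm[symmetric] indicator_def) (auto intro!: prod_le_1)
  have EW: "(\<integral>\<omega>. W \<omega> \<partial>M) =
      (\<Prod>i\<in>A. \<integral>\<omega>. indicator (B i) (Z i \<omega>) \<partial>M) * of_real (exp (- (\<Sum>i\<in>F. (s i)\<^sup>2) / 2))"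
    unfolding W_def using insert by auto
  have "(\<integral>\<omega>. W \<omega> * iexp (t * Z a \<omega>) \<partial>M) = (\<integral>\<omega>. W \<omega> \<partial>M) * (\<integral>\<omega>. iexp (t * Z a \<omega>) \<partial>M)" for t
  proof -
    define s' where "s' = s(a := t)"
    have aF: "a \<notin> F" using insert by auto
    have s': "(\<Sum>i\<in>F. s' i * Z i \<omega>) = (\<Sum>i\<in>F. s i * Z i \<omega>)" "(\<Sum>i\<in>F. (s' i)\<^sup>2) = (\<Sum>i\<in>F. (s i)\<^sup>2)" "s' a = t" for \<omega>
      using aF by (auto simp: s'_def intro!: sum.cong)
    have sum: "(\<Sum>i\<in>insert a F. s' i * Z i \<omega>) = t * Z a \<omega> + (\<Sum>i\<in>F. s i * Z i \<omega>)" 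
         "(\<Sum>i\<in>insert a F. (s' i)\<^sup>2) = t\<^sup>2 + (\<Sum>i\<in>F. (s i)\<^sup>2)" for \<omega>
      using aF insert by (simp_all add: s')
    have "W \<omega> * iexp (t * Z a \<omega>) = (\<Prod>i\<in>A. indicator (B i) (Z i \<omega>)) * iexp (\<Sum>i\<in>insert a F. s' i * Z i \<omega>)" for \<omega>
      unfolding W_def sum by (simp add: exp_add[symmetric] algebra_simps)
    then have "(\<integral>\<omega>. W \<omega> * iexp (t * Z a \<omega>) \<partial>M) =
        (\<integral>\<omega>. (\<Prod>i\<in>A. indicator (B i) (Z i \<omega>)) * iexp (\<Sum>i\<in>insert a F. s' i * Z i \<omega>) \<partial>M)"
      by (simp only:)
    also have "\<dots> = (\<Prod>i\<in>A. \<integral>\<omega>. indicator (B i) (Z i \<omega>) \<partial>M) * of_real (exp (- (\<Sum>i\<in>insert a F. (s' i)\<^sup>2) / 2))"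
      by (rule insert.IH) (use insert.prems insert.hyps in auto)
    also have "exp (- (\<Sum>i\<in>insert a F. (s' i)\<^sup>2) / 2) = exp (- (\<Sum>i\<in>F. (s i)\<^sup>2) / 2) * exp (- t\<^sup>2 / 2)"
      unfolding sum by (simp add: exp_add[symmetric] field_simps)
    also have "of_real (exp (- (\<Sum>i\<in>F. (s i)\<^sup>2) / 2) * exp (- t\<^sup>2 / 2)) =
        complex_of_real (exp (- (\<Sum>i\<in>F. (s i)\<^sup>2) / 2)) * complex_of_real (exp (- t\<^sup>2 / 2))"
      by (rule of_real_mult)
    also have "complex_of_real (exp (- t\<^sup>2 / 2)) = (\<integral>\<omega>. iexp (t * Z a \<omega>) \<partial>M)"
      using char[of "{a}" "\<lambda>_. t"] by simp
    finally show ?thesis by (simp add: EW mult_ac of_real_mult)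
  qed
  from weighted_Levy_uniqueness[OF _ _ B normW this, of a]
  have "(\<integral>\<omega>. W \<omega> * indicator (B a) (Z a \<omega>) \<partial>M) = (\<integral>\<omega>. W \<omega> \<partial>M) * (\<integral>\<omega>. indicator (B a) (Z a \<omega>) \<partial>M)"
    by simp
  moreover have "(\<Prod>i\<in>insert a A. indicator (B i) (Z i \<omega>)) * iexp (\<Sum>i\<in>F. s i * Z i \<omega>) =
      W \<omega> * indicator (B a) (Z a \<omega>)" for \<omega>
    using insert.hyps by (simp add: W_def mult_ac)
  ultimately have "(\<integral>\<omega>. (\<Prod>i\<in>insert a A. indicator (B i) (Z i \<omega>)) * iexp (\<Sum>i\<in>F. s i * Z i \<omega>) \<partial>M) =
      (\<integral>\<omega>. W \<omega> \<partial>M) * (\<integral>\<omega>. indicator (B a) (Z a \<omega>) \<partial>M)"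
    by (simp only:)
  then show ?case
    unfolding EW using insert.hyps by (simp only: prod.insert mult_ac simp_thms)
qed

lemma (in prob_space) std_gaussian_of_char:
  fixes X :: "'a \<Rightarrow> real"
  assumes [measurable]: "X \<in> borel_measurable M"
    and char: "\<And>t. (\<integral>\<omega>. iexp (t * X \<omega>) \<partial>M) = of_real (exp (- t\<^sup>2 / 2))"
  shows "standard_gaussian_rv M X"
proof -
  have "char (distr M borel X) = char std_normal_distribution"
    by (simp add: fun_eq_iff char_std_normal_distribution) (simp add: char_def integral_distr char[simplified])
  then have "distr M borel X = std_normal_distribution"
    by (intro Levy_uniqueness real_dist_normal_dist) auto
  moreover have "distr M lborel X = distr M borel X" by (intro distr_cong) auto
  ultimately show ?thesis
    by (auto simp: standard_gaussian_rv_def distributed_def)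
qed

text \<open>With no exponential left, the mixed factorization is the product formula for the probability of an
  intersection. In this way a family all of whose linear combinations have the law that independent
  standard normal variables would give is itself independent and standard normal.\<close>

theorem (in prob_space) iid_std_gaussian_of_char:
  fixes Z :: "'i \<Rightarrow> 'a \<Rightarrow> real"
  assumes Z [measurable]: "\<And>i. Z i \<in> borel_measurable M"
    and char: "\<And>F s. finite F \<Longrightarrow> (\<integral>\<omega>. iexp (\<Sum>i\<in>F. s i * Z i \<omega>) \<partial>M) = of_real (exp (- (\<Sum>i\<in>F. (s i)\<^sup>2) / 2))"
  shows "standard_gaussian_rv M (Z i)" "indep_vars (\<lambda>_. borel) Z UNIV"
proof -
  show "standard_gaussian_rv M (Z i)"
    using char[of "{i}" "\<lambda>_. t" for t] by (intro std_gaussian_of_char) auto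
  show "indep_vars (\<lambda>_. borel) Z UNIV"
    unfolding indep_vars_def2
  proof (intro conjI ballI indep_setsI)
    fix A and J :: "'i set"
    assume J: "finite J" "J \<noteq> {}" and "\<forall>j\<in>J. A j \<in> {Z j -` A \<inter> space M |A. A \<in> sets borel}"
    then obtain B0 where B0: "\<And>j. j \<in> J \<Longrightarrow> A j = Z j -` B0 j \<inter> space M \<and> B0 j \<in> sets borel"
      by simp metis
    \<comment> \<open>Outside \<open>J\<close> any Borel set will do; a total family is what the factorization expects.\<close>
    define B where "B j = (if j \<in> J then B0 j else {})" for j
    have B: "B j \<in> sets borel" for j using B0 by (auto simp: B_def)
    have A: "A j = Z j -` B j \<inter> space M" if "j \<in> J" for j using B0 that by (auto simp: B_def)
    have [measurable]: "A j \<in> events" if "j \<in> J" for j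
      using A[OF that] B by (auto intro: measurable_sets[OF Z])
    have p: "(\<integral>\<omega>. indicator (B j) (Z j \<omega>) \<partial>M) = complex_of_real (prob (A j))" if "j \<in> J" for j
    proof -
      have "(\<integral>\<omega>. indicator (B j) (Z j \<omega>) \<partial>M) = (\<integral>\<omega>. complex_of_real (indicator (A j) \<omega>) \<partial>M)"
        using A[OF that] by (intro Bochner_Integration.integral_cong) (auto simp: indicator_def)
      then show ?thesis using that by simp
    qed
    have "complex_of_real (prob (\<Inter>j\<in>J. A j)) = (\<integral>\<omega>. complex_of_real (indicator (\<Inter>j\<in>J. A j) \<omega>) \<partial>M)"
      using J by (simp add: sets.finite_INT)
    also have "\<dots> = (\<integral>\<omega>. (\<Prod>j\<in>J. indicator (B j) (Z j \<omega>)) \<partial>M)"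
      using J A by (intro Bochner_Integration.integral_cong) (auto simp: indicator_def prod_zero_iff)
    also have "\<dots> = (\<Prod>j\<in>J. \<integral>\<omega>. indicator (B j) (Z j \<omega>) \<partial>M)"
      using mixed_char_factorization[OF Z B char, where A=J and F="{}" and s="\<lambda>_. 0"] J by simp
    also have "\<dots> = complex_of_real (\<Prod>j\<in>J. prob (A j))" by (simp add: p)
    finally show "prob (\<Inter>j\<in>J. A j) = (\<Prod>j\<in>J. prob (A j))" by (simp only: of_real_eq_iff)
  qed (auto intro: measurable_sets[OF Z])
qed

section \<open>Riemann sums and the trigonometric system\<close>

text \<open>Uniform continuity on the square bounds the error on each cell by \<open>e / N\<close>, with a mesh that does not depend
  on the parameter \<open>t\<close>.\<close>

lemma Riemann_sum_uniform:
  fixes f :: "real \<Rightarrow> real \<Rightarrow> real"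
  assumes f: "continuous_on ({0..1} \<times> {0..1}) (\<lambda>(s, t). f s t)" and "0 < e"
  obtains N0 where "\<And>N t. N0 \<le> N \<Longrightarrow> t \<in> {0..1} \<Longrightarrow>
    \<bar>(\<Sum>j<N. f (real j / real N) t) / real N - integral {0..1} (\<lambda>s. f s t)\<bar> \<le> e"
proof -
  have "uniformly_continuous_on ({0..1} \<times> {0..1}) (\<lambda>(s, t). f s t)"
    by (intro compact_uniformly_continuous f compact_Times) auto
  then obtain d where d: "d > 0" and fd: "\<And>x y. x \<in> {0..1} \<times> {0..1} \<Longrightarrow> y \<in> {0..1} \<times> {0..1} \<Longrightarrow>
      dist y x < d \<Longrightarrow> dist ((\<lambda>(s, t). f s t) y) ((\<lambda>(s, t). f s t) x) < e"
    unfolding uniformly_continuous_on_def using \<open>0 < e\<close> by meson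
  have close: "\<bar>f s t - f s' t\<bar> \<le> e" if "s \<in> {0..1}" "s' \<in> {0..1}" "t \<in> {0..1}" "\<bar>s - s'\<bar> < d" for s s' t
    using fd[of "(s', t)" "(s, t)"] that by (auto simp: dist_Pair_Pair dist_real_def)
  obtain N0 :: nat where N0: "N0 > 0" "1 / real N0 < d"
    using d by (metis nat_approx_posE of_nat_0_less_iff zero_less_Suc)
  show ?thesis
  proof (rule that)
    fix N t assume N: "N0 \<le> N" and t: "t \<in> {0..1::real}"
    have N': "0 < real N" "1 / real N < d"
      using N N0 by (auto intro: order_le_less_trans[OF _ N0(2)] simp: frac_le)
    have cont: "continuous_on {0..1} (\<lambda>s. f s t)"
      using t by (intro continuous_on_compose2[OF f, of _ "\<lambda>s. (s, t)", simplified]) (auto intro!: continuous_intros)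
    have "\<bar>(\<Sum>j<m. f (real j / real N) t) / real N - integral {0..real m / real N} (\<lambda>s. f s t)\<bar> \<le> real m * (e / real N)"
      if "m \<le> N" for m
      using that
    proof (induction m)
      case (Suc m)
      let ?a = "real m / real N" and ?b = "real (Suc m) / real N"
      have ab: "0 \<le> ?a" "?a \<le> ?b" "?b \<le> 1" "?b - ?a = 1 / real N"
        using N' Suc.prems by (auto simp: diff_divide_distrib[symmetric] divide_simps)
      have "{?a..?b} \<subseteq> {0..1}" "{0..?b} \<subseteq> {0..1}"
        unfolding atLeastatMost_subset_iff using ab by linarith+
      from this[THEN continuous_on_subset[OF cont]]
      have c: "continuous_on {?a..?b} (\<lambda>s. f s t)" "continuous_on {0..?b} (\<lambda>s. f s t)" .
      have split: "integral {0..?b} (\<lambda>s. f s t) = integral {0..?a} (\<lambda>s. f s t) + integral {?a..?b} (\<lambda>s. f s t)"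
        using ab c by (intro Henstock_Kurzweil_Integration.integral_combine[symmetric] integrable_continuous_interval) auto
      have "norm (integral {?a..?b} (\<lambda>s. f ?a t - f s t)) \<le> e * (?b - ?a)"
      proof (rule integral_bound)
        show "continuous_on {?a..?b} (\<lambda>s. f ?a t - f s t)" by (intro continuous_intros c)
        fix s assume "s \<in> {?a..?b}"
        then have "?a \<le> s" "s \<le> ?b" by auto
        then have "0 \<le> s" "s \<le> 1" "?a \<le> 1" "\<bar>?a - s\<bar> < d" using ab N'(2) by linarith+
        then show "norm (f ?a t - f s t) \<le> e"
          unfolding real_norm_def using ab(1) t by (intro close) auto
      qed (use ab in auto)
      moreover have "integral {?a..?b} (\<lambda>s. f ?a t - f s t) = f ?a t / real N - integral {?a..?b} (\<lambda>s. f s t)"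
        using c(1) ab by (subst integral_diff) (auto intro!: integrable_continuous_interval)
      ultimately have "\<bar>f ?a t / real N - integral {?a..?b} (\<lambda>s. f s t)\<bar> \<le> e / real N"
        using ab by simp
      then show ?case using Suc split by (simp add: add_divide_distrib distrib_right)
    qed simp
    from this[of N] show "\<bar>(\<Sum>j<N. f (real j / real N) t) / real N - integral {0..1} (\<lambda>s. f s t)\<bar> \<le> e"
      using N' by simp
  qed
qed

text \<open>The orthonormal trigonometric system on the unit interval, \<open>True\<close> marking cosines and \<open>False\<close> sines. The
  index \<open>(False, 0)\<close>, the sine of frequency 0, carries the zero function, which keeps the index set a product.\<close>

definition trig :: "bool \<times> nat \<Rightarrow> real \<Rightarrow> real" where
  "trig i t = (case i of (b, k) \<Rightarrow>
    if k = 0 then of_bool b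
    else sqrt 2 * (if b then cos (2 * real k * pi * t) else sin (2 * real k * pi * t)))"

lemma continuous_on_trig [continuous_intros]:
  fixes g :: "'a :: t2_space \<Rightarrow> real"
  shows "continuous_on A g \<Longrightarrow> continuous_on A (\<lambda>t. trig i (g t))"
  by (cases "snd i = 0"; cases "fst i") (auto simp: trig_def case_prod_beta intro!: continuous_intros)

lemma cos_int_pi [simp]: "cos (2 * real k * pi) = 1" "sin (2 * real k * pi) = 0"
  using cos_int_2pin[of "int k"] sin_int_2pin[of "int k"] by (simp_all add: mult_ac)

lemma integral_cos_period:
  "integral {0..1} (\<lambda>s. cos (2 * real k * pi * s)) = of_bool (k = 0)"
proof (cases "k = 0")
  case False
  have "((\<lambda>s. cos (2 * real k * pi * s)) has_integral
      sin (2 * real k * pi * 1) / (2 * real k * pi) - sin (2 * real k * pi * 0) / (2 * real k * pi)) {0..1}"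
    using False by (intro fundamental_theorem_of_calculus)
      (auto intro!: derivative_eq_intros simp flip: has_real_derivative_iff_has_vector_derivative)
  then show ?thesis using False by (simp add: integral_unique)
qed simp

lemma integral_sin_period:
  "integral {0..1} (\<lambda>s. sin (2 * real k * pi * s)) = 0"
proof (cases "k = 0")
  case False
  have "((\<lambda>s. sin (2 * real k * pi * s)) has_integral
      - cos (2 * real k * pi * 1) / (2 * real k * pi) - (- cos (2 * real k * pi * 0) / (2 * real k * pi))) {0..1}"
    using False by (intro fundamental_theorem_of_calculus)
      (auto intro!: derivative_eq_intros simp flip: has_real_derivative_iff_has_vector_derivative)
  then show ?thesis using False by (simp add: integral_unique)
qed simp

lemma cos_mult_cos_freq:
  "cos (2 * real k * pi * s) * cos (2 * real l * pi * s) =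
   (cos (2 * real (k + l) * pi * s) + cos (2 * real (if k \<ge> l then k - l else l - k) * pi * s)) / 2"
proof -
  have "cos (2 * real (if k \<ge> l then k - l else l - k) * pi * s) = cos (2 * real k * pi * s - 2 * real l * pi * s)"
    by (auto simp: algebra_simps of_nat_diff) (metis cos_minus minus_diff_eq)
  moreover have "cos (2 * real (k + l) * pi * s) = cos (2 * real k * pi * s + 2 * real l * pi * s)"
    by (simp add: algebra_simps)
  ultimately show ?thesis by (simp only:) (simp add: cos_add cos_diff)
qed

lemma sin_mult_sin_freq:
  "sin (2 * real k * pi * s) * sin (2 * real l * pi * s) =
   (cos (2 * real (if k \<ge> l then k - l else l - k) * pi * s) - cos (2 * real (k + l) * pi * s)) / 2"
proof -
  have "cos (2 * real (if k \<ge> l then k - l else l - k) * pi * s) = cos (2 * real k * pi * s - 2 * real l * pi * s)"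
    by (auto simp: algebra_simps of_nat_diff) (metis cos_minus minus_diff_eq)
  moreover have "cos (2 * real (k + l) * pi * s) = cos (2 * real k * pi * s + 2 * real l * pi * s)"
    by (simp add: algebra_simps)
  ultimately show ?thesis by (simp only:) (simp add: cos_add cos_diff)
qed

lemma integral_cos_mult_cos:
  "integral {0..1} (\<lambda>s. cos (2 * real k * pi * s) * cos (2 * real l * pi * s)) =
    (if k = l then if k = 0 then 1 else 1 / 2 else 0)"
proof -
  have "integral {0..1} (\<lambda>s. cos (2 * real k * pi * s) * cos (2 * real l * pi * s)) =
    (of_bool (k + l = 0) + of_bool ((if k \<ge> l then k - l else l - k) = 0)) / 2"
    unfolding cos_mult_cos_freq
    by (simp only: integral_divide Henstock_Kurzweil_Integration.integral_add integral_cos_period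
        integrable_continuous_interval continuous_intros)
  then show ?thesis by (auto split: if_splits)
qed

lemma integral_sin_mult_sin:
  "integral {0..1} (\<lambda>s. sin (2 * real k * pi * s) * sin (2 * real l * pi * s)) =
    (if k = l \<and> k \<noteq> 0 then 1 / 2 else 0)"
proof -
  have "integral {0..1} (\<lambda>s. sin (2 * real k * pi * s) * sin (2 * real l * pi * s)) =
    (of_bool ((if k \<ge> l then k - l else l - k) = 0) - of_bool (k + l = 0)) / 2"
    unfolding sin_mult_sin_freq
    by (simp only: integral_divide Henstock_Kurzweil_Integration.integral_diff integral_cos_period
        integrable_continuous_interval continuous_intros)
  then show ?thesis by (auto split: if_splits)
qed

lemma integral_reflect_unit:
  fixes f :: "real \<Rightarrow> real"
  shows "integral {0..1} (\<lambda>u. f (1 - u)) = integral {0..1} f"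
proof -
  have "integral {-1..0} (\<lambda>u. f (1 - - u)) = integral {0..1} (\<lambda>u. f (1 - u))"
    using Henstock_Kurzweil_Integration.integral_reflect_real[of 1 0 "\<lambda>u. f (1 - u)"] by (simp only: minus_zero)
  moreover have "integral {-1..0} (\<lambda>u. f (1 - - u)) = integral {0..1} f"
    using integral_shift_Icc_real[of "-1" 0 f 1] by (simp add: o_def)
  ultimately show ?thesis by simp
qed

section \<open>Completeness of the cosines\<close>

inductive cos_poly :: "(real \<Rightarrow> real) \<Rightarrow> bool" where
  cos_poly_cos: "cos_poly (\<lambda>u. c * cos (2 * real k * pi * u))"
| cos_poly_add: "cos_poly f \<Longrightarrow> cos_poly g \<Longrightarrow> cos_poly (\<lambda>u. f u + g u)"

text \<open>The product-to-sum formula, on which closure of cosine polynomials under multiplication rests.\<close>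

lemma cos_poly_mult_cos:
  assumes "cos_poly f"
  shows "cos_poly (\<lambda>u. f u * (d * cos (2 * real l * pi * u)))"
  using assms
proof induction
  case (cos_poly_cos c k)
  have "(\<lambda>u. c * cos (2 * real k * pi * u) * (d * cos (2 * real l * pi * u))) =
    (\<lambda>u. c * d / 2 * cos (2 * real (k + l) * pi * u) +
         c * d / 2 * cos (2 * real (if k \<ge> l then k - l else l - k) * pi * u))"
  proof
    fix u
    have "c * cos (2 * real k * pi * u) * (d * cos (2 * real l * pi * u)) =
        c * d * (cos (2 * real k * pi * u) * cos (2 * real l * pi * u))" by (simp only: mult_ac)
    then show "c * cos (2 * real k * pi * u) * (d * cos (2 * real l * pi * u)) =
         c * d / 2 * cos (2 * real (k + l) * pi * u) +
         c * d / 2 * cos (2 * real (if k \<ge> l then k - l else l - k) * pi * u)"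
      unfolding cos_mult_cos_freq by (simp only: distrib_left times_divide_eq_left times_divide_eq_right add_divide_distrib)
  qed
  then show ?case by (simp only: cos_poly.intros)
next
  case (cos_poly_add f g)
  then show ?case using cos_poly.cos_poly_add by (simp add: distrib_right)
qed

lemma cos_poly_mult:
  assumes "cos_poly g" "cos_poly f"
  shows "cos_poly (\<lambda>u. f u * g u)"
  using assms(1)
proof induction
  case (cos_poly_cos d l)
  then show ?case by (rule cos_poly_mult_cos[OF assms(2)])
next
  case (cos_poly_add g h)
  then show ?case using cos_poly.cos_poly_add by (simp add: distrib_left)
qed

lemma continuous_on_cos_poly: "cos_poly f \<Longrightarrow> continuous_on A f"
  by (induction rule: cos_poly.induct) (intro continuous_intros; assumption)+

lemma cos_poly_reflect: "cos_poly f \<Longrightarrow> f (1 - u) = f u"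
  by (induction rule: cos_poly.induct) (simp_all add: right_diff_distrib cos_diff)

lemma integral_mult_cos_poly:
  assumes "cos_poly g" and R: "continuous_on {0..1} R"
    and "\<And>k::nat. integral {0..1} (\<lambda>u. R u * cos (2 * real k * pi * u)) = 0"
  shows "integral {0..1} (\<lambda>u. R u * g u) = 0"
  using assms(1)
proof induction
  case (cos_poly_cos c k)
  have "integral {0..1} (\<lambda>u. R u * (c * cos (2 * real k * pi * u))) =
      integral {0..1} (\<lambda>u. c * (R u * cos (2 * real k * pi * u)))" by (simp only: mult_ac)
  then show ?case using assms(3) by simp
next
  case (cos_poly_add f g)
  have "integral {0..1} (\<lambda>u. R u * (f u + g u)) = integral {0..1} (\<lambda>u. R u * f u) + integral {0..1} (\<lambda>u. R u * g u)"
    unfolding distrib_left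
    by (intro Henstock_Kurzweil_Integration.integral_add integrable_continuous_interval continuous_intros R
        continuous_on_cos_poly cos_poly_add)
  then show ?case using cos_poly_add by simp
qed

text \<open>On \<open>[0, 1/2]\<close> the cosines separate points, so by Stone--Weierstrass cosine polynomials \<open>g\<close> approximate \<open>R\<close>
  uniformly there, and by the symmetry of both on all of \<open>[0, 1]\<close>. As \<open>R\<close> is orthogonal to \<open>g\<close>, the integral of
  \<open>R\<^sup>2\<close> equals that of \<open>R (R - g)\<close> and is arbitrarily small.\<close>

lemma cosine_system_complete:
  fixes R :: "real \<Rightarrow> real"
  assumes R: "continuous_on {0..1} R" and sym: "\<And>u. u \<in> {0..1} \<Longrightarrow> R (1 - u) = R u"
    and orth: "\<And>k::nat. integral {0..1} (\<lambda>u. R u * cos (2 * real k * pi * u)) = 0"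
    and "u \<in> {0..1}"
  shows "R u = 0"
proof -
  have approx: "\<exists>g. cos_poly g \<and> (\<forall>u\<in>{0..1}. \<bar>R u - g u\<bar> < e)" if "e > 0" for e
  proof -
    have "\<exists>g. cos_poly g \<and> (\<forall>u\<in>{0..1/2}. \<bar>R u - g u\<bar> < e)"
    proof (rule Stone_Weierstrass_HOL)
      show "cos_poly (\<lambda>x. c)" for c using cos_poly_cos[of c 0] by simp
      show "continuous_on {0..1/2} f" if "cos_poly f" for f using that by (rule continuous_on_cos_poly)
      show "continuous_on {0..1/2} R" using R by (rule continuous_on_subset) auto
      fix x y :: real assume xy: "x \<in> {0..1/2} \<and> y \<in> {0..1/2} \<and> x \<noteq> y"
      then have "cos (2 * pi * x) \<noteq> cos (2 * pi * y)"
        using cos_inj_pi[of "2 * pi * x" "2 * pi * y"] by (auto simp: field_simps)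
      then show "\<exists>f. cos_poly f \<and> f x \<noteq> f y"
        using cos_poly_cos[of 1 1] by (auto intro!: exI[of _ "\<lambda>u. cos (2 * pi * u)"])
    qed (use that cos_poly_add cos_poly_mult in auto)
    then obtain g where g: "cos_poly g" "\<And>u. u \<in> {0..1/2} \<Longrightarrow> \<bar>R u - g u\<bar> < e" by blast
    have "\<bar>R u - g u\<bar> < e" if "u \<in> {0..1}" for u
    proof (cases "u \<le> 1 / 2")
      case False
      then show ?thesis using g(2)[of "1 - u"] that sym[of u] cos_poly_reflect[OF g(1), of u] by simp
    qed (use that g in auto)
    then show ?thesis using g by blast
  qed
  define K where "K = integral {0..1} (\<lambda>u. \<bar>R u\<bar>)"
  have K0: "0 \<le> K" unfolding K_def by (intro integral_nonneg integrable_continuous_interval continuous_intros R) auto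
  define I where "I = integral {0..1} (\<lambda>u. (R u)\<^sup>2)"
  have "I \<le> e" if "e > 0" for e
  proof -
    define \<delta> where "\<delta> = e / (K + 1)"
    have "0 < \<delta>" unfolding \<delta>_def using that K0 by simp
    from approx[OF this]
    obtain g where g: "cos_poly g" "\<And>u. u \<in> {0..1} \<Longrightarrow> \<bar>R u - g u\<bar> < \<delta>" by blast
    have cg: "continuous_on {0..1} g" using g(1) by (rule continuous_on_cos_poly)
    have "I = integral {0..1} (\<lambda>u. (R u)\<^sup>2 - R u * g u)"
      unfolding I_def using integral_mult_cos_poly[OF g(1) R orth]
      by (subst Henstock_Kurzweil_Integration.integral_diff)
         (auto intro!: integrable_continuous_interval continuous_intros R cg)
    also have "\<dots> \<le> integral {0..1} (\<lambda>u. \<bar>R u\<bar> * (\<delta>))"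
    proof (rule integral_le)
      fix u :: real assume u: "u \<in> {0..1}"
      have "(R u)\<^sup>2 - R u * g u = R u * (R u - g u)" by (simp add: power2_eq_square right_diff_distrib)
      also have "\<dots> \<le> \<bar>R u\<bar> * \<bar>R u - g u\<bar>" by (metis abs_ge_self abs_mult)
      also have "\<dots> \<le> \<bar>R u\<bar> * (\<delta>)" using g(2)[OF u] by (intro mult_left_mono) auto
      finally show "(R u)\<^sup>2 - R u * g u \<le> \<bar>R u\<bar> * (\<delta>)" .
    qed (auto intro!: integrable_continuous_interval continuous_intros R cg)
    also have "\<dots> = K * (e / (K + 1))" by (simp add: K_def \<delta>_def)
    also have "\<dots> \<le> e" using K0 that by (simp add: field_simps)
    finally show ?thesis .
  qed
  then have "I \<le> 0" by (rule field_le_epsilon[of I 0, simplified])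
  moreover have "0 \<le> I"
    unfolding I_def by (intro integral_nonneg integrable_continuous_interval continuous_intros R) auto
  ultimately have "integral {0..1} (\<lambda>u. (R u)\<^sup>2) = 0" by (simp add: I_def)
  then have "\<forall>u\<in>{0..1}. (R u)\<^sup>2 = 0"
    by (subst (asm) integral_eq_0_iff) (auto intro!: continuous_intros R)
  then show ?thesis using assms(4) by auto
qed

section \<open>Periodic covariograms\<close>

text \<open>The covariogram of a stationary process \<open>x\<close> with \<open>x 0 = x 1\<close> almost surely. It is given on \<open>[-1, 1]\<close> only;
  the two equations say that it extends to an even function of period 1.\<close>

locale periodic_covariogram =
  fixes C :: "real \<Rightarrow> real"
  assumes cont: "continuous_on {-1..1} C"
    and even: "\<And>u. u \<in> {0..1} \<Longrightarrow> C (- u) = C u"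
    and periodic: "\<And>u. u \<in> {0..1} \<Longrightarrow> C (u - 1) = C u"
begin

definition coef :: "nat \<Rightarrow> real" where
  "coef k = integral {0..1} (\<lambda>s. C s * cos (2 * real k * pi * s))"

lemma continuous_on_C [continuous_intros]: "continuous_on {0..1} C"
  using cont by (rule continuous_on_subset) auto

lemma C_reflect: "u \<in> {0..1} \<Longrightarrow> C (1 - u) = C u"
  using even[of "1 - u"] periodic[of u] by simp

text \<open>Translation invariance of the integral over a period. After the shift the domain is \<open>[-t, 1 - t]\<close>, and the
  piece \<open>[-t, 0]\<close> is moved by one period to \<open>[1 - t, 1]\<close>.\<close>

lemma integral_shift_periodic:
  fixes g :: "real \<Rightarrow> real"
  assumes g: "continuous_on UNIV g" "\<And>s. g (s + 1) = g s" and t: "t \<in> {0..1}"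
  shows "integral {0..1} (\<lambda>s. C (s - t) * g s) = integral {0..1} (\<lambda>u. C u * g (u + t))"
proof -
  define h where "h u = C u * g (u + t)" for u
  have g': "continuous_on A g" for A using g(1) by (rule continuous_on_subset) auto
  have h: "continuous_on {-1..1} h"
    unfolding h_def by (intro continuous_intros cont continuous_on_compose2[OF g(1)]) auto
  then have int: "h integrable_on {a..b}" if "-1 \<le> a" "b \<le> 1" for a b
    using that by (intro integrable_continuous_interval) (auto elim: continuous_on_subset)
  have "integral {0..1} (\<lambda>s. C (s - t) * g s) = integral {0..1} (h \<circ> (+) (- t))"
    by (simp add: h_def o_def)
  also have "\<dots> = integral {- t..1 - t} h" by (subst integral_shift_Icc_real) simp
  also have "\<dots> = integral {- t..0} h + integral {0..1 - t} h"
    using t int by (intro Henstock_Kurzweil_Integration.integral_combine[symmetric]) auto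
  also have "integral {- t..0} h = integral {1 - t..1} (h \<circ> (+) (- 1))"
    by (subst integral_shift_Icc_real) simp
  also have "\<dots> = integral {1 - t..1} h"
  proof (rule Henstock_Kurzweil_Integration.integral_cong)
    fix u assume "u \<in> {1 - t..1}"
    then show "(h \<circ> (+) (- 1)) u = h u"
      using periodic[of u] t g(2)[of "u - 1 + t"] by (simp add: h_def add.commute)
  qed
  also have "integral {1 - t..1} h + integral {0..1 - t} h = integral {0..1} h"
    using t int by (subst add.commute, intro Henstock_Kurzweil_Integration.integral_combine) auto
  finally show ?thesis unfolding h_def[abs_def] .
qed

lemma integral_C_sin: "integral {0..1} (\<lambda>s. C s * sin (2 * real k * pi * s)) = 0"
proof -
  have "integral {0..1} (\<lambda>s. C s * sin (2 * real k * pi * s)) =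
      integral {0..1} (\<lambda>s. C (1 - s) * sin (2 * real k * pi * (1 - s)))"
    by (rule integral_reflect_unit[symmetric])
  also have "\<dots> = integral {0..1} (\<lambda>s. - (C s * sin (2 * real k * pi * s)))"
    by (intro Henstock_Kurzweil_Integration.integral_cong)
       (simp add: C_reflect right_diff_distrib sin_diff)
  finally show ?thesis by simp
qed

text \<open>The covariance operator diagonalizes in the trigonometric system. Shifting the integral by \<open>t\<close> and expanding
  \<open>cos (u + t)\<close> or \<open>sin (u + t)\<close> leaves only the cosine coefficient of \<open>C\<close>, as the sine coefficient vanishes by
  evenness.\<close>

lemma trig_eigenfunction:
  assumes t: "t \<in> {0..1}"
  shows "integral {0..1} (\<lambda>s. C (s - t) * trig i s) = coef (snd i) * trig i t"
proof -
  let ?k = "snd i"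
  let ?c = "\<lambda>u. cos (2 * real ?k * pi * u)" and ?s = "\<lambda>u. sin (2 * real ?k * pi * u)"
  have "integral {0..1} (\<lambda>s. C (s - t) * ?c s) = integral {0..1} (\<lambda>u. C u * ?c (u + t))"
    by (rule integral_shift_periodic) (use t in \<open>auto intro!: continuous_intros simp: distrib_left cos_add\<close>)
  also have "\<dots> = integral {0..1} (\<lambda>u. (C u * ?c u) * ?c t - (C u * ?s u) * ?s t)"
    by (simp add: distrib_left cos_add right_diff_distrib mult.assoc)
  also have "\<dots> = coef ?k * ?c t"
    by (subst Henstock_Kurzweil_Integration.integral_diff)
       (auto intro!: integrable_continuous_interval continuous_intros simp: integral_C_sin coef_def)
  finally have cos: "integral {0..1} (\<lambda>s. C (s - t) * ?c s) = coef ?k * ?c t" .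
  have "integral {0..1} (\<lambda>s. C (s - t) * ?s s) = integral {0..1} (\<lambda>u. C u * ?s (u + t))"
    by (rule integral_shift_periodic) (use t in \<open>auto intro!: continuous_intros simp: distrib_left sin_add\<close>)
  also have "\<dots> = integral {0..1} (\<lambda>u. (C u * ?s u) * ?c t + (C u * ?c u) * ?s t)"
    by (simp add: distrib_left sin_add mult.assoc)
  also have "\<dots> = coef ?k * ?s t"
    by (subst Henstock_Kurzweil_Integration.integral_add)
       (auto intro!: integrable_continuous_interval continuous_intros simp: integral_C_sin coef_def)
  finally have sin: "integral {0..1} (\<lambda>s. C (s - t) * ?s s) = coef ?k * ?s t" .
  obtain b k where i: "i = (b, k)" by (cases i)
  have "integral {0..1} (\<lambda>s. C (s - t) * (sqrt 2 * f s)) = sqrt 2 * integral {0..1} (\<lambda>s. C (s - t) * f s)" for f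
    by (simp only: mult.left_commute[of _ "sqrt 2"] Henstock_Kurzweil_Integration.integral_mult_right)
  then show ?thesis using cos sin by (cases "k = 0") (simp_all add: i trig_def)
qed

text \<open>The cosine series of \<open>C\<close> converges at 0 to the right value. Nonnegative coefficients with bounded partial sums
  are summable, so the series converges uniformly to a continuous \<open>G\<close> with the coefficients of \<open>C\<close>; by
  completeness of the cosines \<open>C - G\<close> vanishes.\<close>

lemma coef_sums:
  assumes nonneg: "\<And>k. 0 \<le> coef k"
    and bound: "\<And>n. coef 0 + 2 * (\<Sum>k=1..n. coef k) \<le> C 0"
  shows "summable coef" "(\<lambda>n. coef 0 + 2 * (\<Sum>k=1..n. coef k)) \<longlonglongrightarrow> C 0"
proof -
  \<comment> \<open>Each positive frequency has two basis functions, frequency 0 only one.\<close>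
  define w where "w k = (if k = 0 then 1 else 2 :: real)" for k :: nat
  have sum_w: "(\<Sum>k\<le>n. w k * coef k) = coef 0 + 2 * (\<Sum>k=1..n. coef k)" for n
  proof -
    have "(\<Sum>k\<le>n. w k * coef k) = w 0 * coef 0 + (\<Sum>k=1..n. w k * coef k)"
      by (simp add: atMost_atLeast0 sum.atLeast_Suc_atMost)
    also have "(\<Sum>k=1..n. w k * coef k) = (\<Sum>k=1..n. 2 * coef k)" by (intro sum.cong) (auto simp: w_def)
    finally show ?thesis by (simp add: w_def sum_distrib_left)
  qed
  have w: "summable (\<lambda>k. w k * coef k)"
    by (rule bounded_imp_summable[where B="C 0"]) (use nonneg bound sum_w in \<open>auto simp: w_def\<close>)
  show "summable coef"
    by (rule summable_comparison_test[OF _ w]) (use nonneg in \<open>auto simp: w_def\<close>)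
  define G where "G u = (\<Sum>k. w k * coef k * cos (2 * real k * pi * u))" for u
  have abs_le: "norm (w k * coef k * x) \<le> w k * coef k" if "\<bar>x\<bar> \<le> 1" for k x
    using nonneg that by (auto simp: abs_mult w_def intro: mult_left_le)
  have cos_le: "norm (w k * coef k * cos y) \<le> w k * coef k" for k y by (rule abs_le) simp
  have cos2_le: "norm (w k * coef k * cos y * cos z) \<le> w k * coef k" for k y z
    unfolding mult.assoc[of _ "cos y"] by (rule abs_le) (auto simp: abs_mult intro: mult_le_one)
  have "uniform_limit {0..1} (\<lambda>n u. \<Sum>k<n. w k * coef k * cos (2 * real k * pi * u)) G sequentially"
    unfolding G_def using cos_le w by (rule Weierstrass_m_test)
  then have G: "continuous_on {0..1} G"
    by (rule uniform_limit_theorem[rotated]) (auto intro!: always_eventually continuous_intros)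
  have GI: "integral {0..1} (\<lambda>u. G u * cos (2 * real l * pi * u)) = coef l" for l
  proof -
    define p where "p n u = (\<Sum>k<n. w k * coef k * cos (2 * real k * pi * u) * cos (2 * real l * pi * u))" for n u
    have p: "continuous_on {0..1} (p n)" for n unfolding p_def by (intro continuous_intros)
    have "G u * cos (2 * real l * pi * u) = (\<Sum>k. w k * coef k * cos (2 * real k * pi * u) * cos (2 * real l * pi * u))" for u
      unfolding G_def by (intro suminf_mult2 summable_comparison_test[OF _ w] exI[of _ 0] allI impI cos_le)
    then have "uniform_limit {0..1} p (\<lambda>u. G u * cos (2 * real l * pi * u)) sequentially"
      unfolding p_def by (simp only:) (rule Weierstrass_m_test[OF cos2_le w])
    then obtain I J where IJ: "\<And>n. (p n has_integral I n) {0..1}"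
      "((\<lambda>u. G u * cos (2 * real l * pi * u)) has_integral J) {0..1}" "I \<longlonglongrightarrow> J"
      using p by (rule uniform_limit_integral) auto
    have "I n = coef l" if "n > l" for n
    proof -
      have "I n = integral {0..1} (p n)" using Henstock_Kurzweil_Integration.integral_unique[OF IJ(1)[of n]] by simp
      also have "\<dots> = (\<Sum>k<n. w k * coef k * integral {0..1} (\<lambda>u. cos (2 * real k * pi * u) * cos (2 * real l * pi * u)))"
        unfolding p_def mult.assoc[of _ "cos _" "cos _"]
        by (subst Henstock_Kurzweil_Integration.integral_sum)
           (auto intro!: integrable_continuous_interval continuous_intros)
      also have "\<dots> = (\<Sum>k<n. if k = l then coef l else 0)"
        by (intro sum.cong) (auto simp: integral_cos_mult_cos w_def)
      finally show ?thesis using that by simp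
    qed
    then have "I \<longlonglongrightarrow> coef l"
      by (intro tendsto_eventually eventually_sequentiallyI[of "Suc l"]) auto
    then show ?thesis using IJ LIMSEQ_unique by (auto simp: integral_unique)
  qed
  have "C 0 - G 0 = 0"
  proof (rule cosine_system_complete[where R="\<lambda>u. C u - G u" and u=0])
    show "continuous_on {0..1} (\<lambda>u. C u - G u)" by (intro continuous_intros G)
    have "cos (2 * real k * pi * (1 - u)) = cos (2 * real k * pi * u)" for k u
      by (simp add: right_diff_distrib cos_diff)
    then show "C (1 - u) - G (1 - u) = C u - G u" if "u \<in> {0..1}" for u
      using that by (simp only: C_reflect G_def)
    fix k
    show "integral {0..1} (\<lambda>u. (C u - G u) * cos (2 * real k * pi * u)) = 0"
      unfolding left_diff_distrib
      by (subst Henstock_Kurzweil_Integration.integral_diff)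
         (auto intro!: integrable_continuous_interval continuous_intros G simp: GI coef_def)
  qed auto
  then show "(\<lambda>n. coef 0 + 2 * (\<Sum>k=1..n. coef k)) \<longlonglongrightarrow> C 0"
    using summable_LIMSEQ'[OF w] unfolding sum_w by (simp add: G_def)
qed

end

section \<open>Random Fourier coefficients\<close>

text \<open>The two kinds of Gaussian laws, normal densities and point masses, have the same formula for the characteristic
  function once the mean is 0.\<close>

lemma (in prob_space) centred_gaussian_rv:
  assumes X: "gaussian_rv M X" and mean: "(\<integral>\<omega>. X \<omega> \<partial>M) = 0"
  shows "square_integrable M X"
    and "(\<integral>\<omega>. iexp (X \<omega>) \<partial>M) = of_real (exp (- mean_product M X X / 2))"
proof -
  have [measurable]: "X \<in> borel_measurable M" using X by (simp add: gaussian_rv_def)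
  consider \<mu> \<sigma> where "\<sigma> > 0" "distributed M lborel X (normal_density \<mu> \<sigma>)"
    | \<mu> where "AE \<omega> in M. X \<omega> = \<mu>"
    using X by (auto simp: gaussian_rv_def)
  then have "square_integrable M X \<and> (\<integral>\<omega>. iexp (X \<omega>) \<partial>M) = of_real (exp (- mean_product M X X / 2))"
  proof cases
    case 1
    have \<mu>: "\<mu> = 0" using normal_distributed_expectation[OF 1] mean by simp
    have "integrable M (\<lambda>\<omega>. (X \<omega>)\<^sup>2)"
      using integrable_normal_moment[OF 1(1), of \<mu> 2] distributed_integrable[OF 1(2), of "\<lambda>x. x\<^sup>2"]
      by (simp add: \<mu>)
    moreover have "mean_product M X X = \<sigma>\<^sup>2"
      using normal_distributed_variance[OF 1] mean by (simp add: mean_product_def power2_eq_square)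
    moreover have "(\<integral>\<omega>. iexp (X \<omega>) \<partial>M) = of_real (exp (- \<sigma>\<^sup>2 / 2))"
    proof -
      have "distributed M lborel (\<lambda>\<omega>. X \<omega> / \<sigma>) std_normal_density"
        using normal_standard_normal_convert[OF 1(1), of X \<mu>] 1(2) by (simp add: \<mu>)
      then have "std_normal_distribution = distr M lborel (\<lambda>\<omega>. X \<omega> / \<sigma>)"
        by (simp add: distributed_def)
      then have "char std_normal_distribution \<sigma> = (\<integral>\<omega>. iexp (\<sigma> * (X \<omega> / \<sigma>)) \<partial>M)"
        using 1(1) by (simp add: char_def integral_distr)
      then show ?thesis using 1(1) by (simp add: char_std_normal_distribution)
    qed
    ultimately show ?thesis by (simp add: square_integrable_def)
  next
    case 2
    have "(\<integral>\<omega>. X \<omega> \<partial>M) = (\<integral>\<omega>. \<mu> \<partial>M)" using 2 by (intro integral_cong_AE) auto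
    then have 0: "AE \<omega> in M. X \<omega> = 0" using 2 mean by (simp add: prob_space)
    have "integrable M (\<lambda>\<omega>. (X \<omega>)\<^sup>2) \<longleftrightarrow> integrable M (\<lambda>\<omega>. 0 :: real)"
      using 0 by (intro integrable_cong_AE) auto
    moreover have "mean_product M X X = (\<integral>\<omega>. 0 \<partial>M)"
      unfolding mean_product_def using 0 by (intro integral_cong_AE) auto
    moreover have "(\<integral>\<omega>. iexp (X \<omega>) \<partial>M) = (\<integral>\<omega>. 1 \<partial>M)"
      using 0 by (intro integral_cong_AE) auto
    ultimately show ?thesis by (simp add: square_integrable_def prob_space)
  qed
  then show "square_integrable M X"
    "(\<integral>\<omega>. iexp (X \<omega>) \<partial>M) = of_real (exp (- mean_product M X X / 2))" by auto
qed

text \<open>Covariances are expressed by \<open>mean_product\<close>, as the process is centred.\<close>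

locale periodic_gaussian_process = prob_space M + periodic_covariogram C
  for M :: "'a measure" and C :: "real \<Rightarrow> real" +
  fixes x :: "real \<Rightarrow> 'a \<Rightarrow> real"
  assumes gaussian: "gaussian_process M {0..1} x"
    and centred: "\<And>t. t \<in> {0..1} \<Longrightarrow> (\<integral>\<omega>. x t \<omega> \<partial>M) = 0"
    and covariance: "\<And>s t. s \<in> {0..1} \<Longrightarrow> t \<in> {0..1} \<Longrightarrow> mean_product M (x s) (x t) = C (s - t)"
begin

lemma gaussian_combination:
  "finite F \<Longrightarrow> F \<subseteq> {0..1} \<Longrightarrow> gaussian_rv M (\<lambda>\<omega>. \<Sum>t\<in>F. a t * x t \<omega>)"
  using gaussian by (simp add: gaussian_process_def)

lemma square_integrable_x: "t \<in> {0..1} \<Longrightarrow> square_integrable M (x t)"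
  using gaussian_combination[of "{t}" "\<lambda>_. 1"] centred_gaussian_rv(1) centred by simp

definition linear_combination :: "('a \<Rightarrow> real) \<Rightarrow> bool" where
  "linear_combination L \<longleftrightarrow> (\<exists>F a. finite F \<and> F \<subseteq> {0..1} \<and> L = (\<lambda>\<omega>. \<Sum>t\<in>F. a t * x t \<omega>))"

lemma linear_combination_x: "t \<in> {0..1} \<Longrightarrow> linear_combination (x t)"
  unfolding linear_combination_def by (rule exI[of _ "{t}"], rule exI[of _ "\<lambda>_. 1"]) auto

lemma linear_combination_0: "linear_combination (\<lambda>_. 0)"
  unfolding linear_combination_def by (rule exI[of _ "{}"]) auto

lemma linear_combination_cmult:
  assumes "linear_combination L" shows "linear_combination (\<lambda>\<omega>. c * L \<omega>)"
proof -
  obtain F a where F: "finite F" "F \<subseteq> {0..1}" "L = (\<lambda>\<omega>. \<Sum>t\<in>F. a t * x t \<omega>)"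
    using assms unfolding linear_combination_def by auto
  then have "(\<lambda>\<omega>. c * L \<omega>) = (\<lambda>\<omega>. \<Sum>t\<in>F. (c * a t) * x t \<omega>)"
    by (simp add: sum_distrib_left mult.assoc)
  with F(1,2) show ?thesis unfolding linear_combination_def
    by (intro exI[of _ F] exI[of _ "\<lambda>t. c * a t"] conjI)
qed

lemma linear_combination_add:
  assumes "linear_combination L" "linear_combination L'" shows "linear_combination (\<lambda>\<omega>. L \<omega> + L' \<omega>)"
proof -
  obtain F a F' a' where F: "finite F" "F \<subseteq> {0..1}" "L = (\<lambda>\<omega>. \<Sum>t\<in>F. a t * x t \<omega>)"
    and F': "finite F'" "F' \<subseteq> {0..1}" "L' = (\<lambda>\<omega>. \<Sum>t\<in>F'. a' t * x t \<omega>)"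
    using assms unfolding linear_combination_def by auto
  define b where "b t = (if t \<in> F then a t else 0) + (if t \<in> F' then a' t else 0)" for t
  have "L \<omega> + L' \<omega> = (\<Sum>t\<in>F \<union> F'. b t * x t \<omega>)" for \<omega>
  proof -
    have "L \<omega> = (\<Sum>t\<in>F \<union> F'. (if t \<in> F then a t else 0) * x t \<omega>)"
      unfolding F(3) using F F' by (intro sum.mono_neutral_cong_left) auto
    moreover have "L' \<omega> = (\<Sum>t\<in>F \<union> F'. (if t \<in> F' then a' t else 0) * x t \<omega>)"
      unfolding F'(3) using F F' by (intro sum.mono_neutral_cong_left) auto
    ultimately show ?thesis by (simp add: b_def distrib_right sum.distrib)
  qed
  then show ?thesis
    unfolding linear_combination_def using F F' by (intro exI[of _ "F \<union> F'"] exI[of _ b]) auto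
qed

lemma linear_combination_sum: "(\<And>j. j \<in> J \<Longrightarrow> linear_combination (L j)) \<Longrightarrow> linear_combination (\<lambda>\<omega>. \<Sum>j\<in>J. L j \<omega>)"
  by (induction J rule: infinite_finite_induct) (auto intro: linear_combination_0 linear_combination_add)

lemma linear_combination_char:
  assumes "linear_combination L"
  shows "square_integrable M L" "(\<integral>\<omega>. iexp (L \<omega>) \<partial>M) = of_real (exp (- mean_product M L L / 2))"
proof -
  obtain F a where F: "finite F" "F \<subseteq> {0..1}" "L = (\<lambda>\<omega>. \<Sum>t\<in>F. a t * x t \<omega>)"
    using assms unfolding linear_combination_def by auto
  have "(\<integral>\<omega>. L \<omega> \<partial>M) = (\<Sum>t\<in>F. a t * (\<integral>\<omega>. x t \<omega> \<partial>M))"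
    unfolding F(3) using F square_integrable_integrable[OF square_integrable_x]
    by (subst Bochner_Integration.integral_sum) auto
  also have "\<dots> = 0" using F centred by (intro sum.neutral) auto
  finally have mean: "(\<integral>\<omega>. L \<omega> \<partial>M) = 0" .
  have "gaussian_rv M L" unfolding F(3) by (rule gaussian_combination[OF F(1,2)])
  from centred_gaussian_rv[OF this mean] show "square_integrable M L" "(\<integral>\<omega>. iexp (L \<omega>) \<partial>M) = of_real (exp (- mean_product M L L / 2))" .
qed

text \<open>The Gaussian Hilbert space of the process: mean-square limits of linear combinations. All its elements are
  centred Gaussian, so a joint characteristic function of several of them is determined by second moments.\<close>

definition gaussian_space :: "('a \<Rightarrow> real) set" where
  "gaussian_space = {X. square_integrable M X \<and> (\<exists>L. (\<forall>n. linear_combination (L n)) \<and> ms_limit M L X)}"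

lemma gaussian_spaceI:
  "square_integrable M X \<Longrightarrow> (\<And>n. linear_combination (L n)) \<Longrightarrow> ms_limit M L X \<Longrightarrow> X \<in> gaussian_space"
  unfolding gaussian_space_def by (intro CollectI conjI exI[of _ L] allI)

lemma gaussian_spaceE:
  assumes "X \<in> gaussian_space"
  obtains L where "square_integrable M X" "\<forall>n. linear_combination (L n)" "ms_limit M L X"
  using assms unfolding gaussian_space_def by blast

lemma gaussian_space_char:
  assumes "X \<in> gaussian_space"
  shows "(\<integral>\<omega>. iexp (X \<omega>) \<partial>M) = of_real (exp (- mean_product M X X / 2))"
proof -
  obtain L where X: "square_integrable M X" and L: "\<forall>n. linear_combination (L n)" "ms_limit M L X"
    using assms by (rule gaussian_spaceE)
  note L = L(1)[rule_format] L(2)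
  note sq = linear_combination_char(1)[OF L(1)]
  have "(\<lambda>n. \<integral>\<omega>. iexp (L n \<omega>) \<partial>M) \<longlonglongrightarrow> of_real (exp (- mean_product M X X / 2))"
    unfolding linear_combination_char(2)[OF L(1)] by (intro tendsto_intros mean_square_ms_limit[OF sq X L(2)]) auto
  with iexp_ms_limit[OF sq X L(2)] show ?thesis by (rule LIMSEQ_unique)
qed

lemma gaussian_space_cmult:
  assumes "X \<in> gaussian_space" shows "(\<lambda>\<omega>. c * X \<omega>) \<in> gaussian_space"
proof -
  obtain L where L: "square_integrable M X" "\<forall>n. linear_combination (L n)" "ms_limit M L X"
    using assms by (rule gaussian_spaceE)
  show ?thesis
    by (rule gaussian_spaceI[OF square_integrable_cmult[OF L(1)] linear_combination_cmult[OF L(2)[rule_format]] ms_limit_cmult[OF L(3)]])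
qed

lemma gaussian_space_add:
  assumes "X \<in> gaussian_space" "Y \<in> gaussian_space"
  shows "(\<lambda>\<omega>. X \<omega> + Y \<omega>) \<in> gaussian_space"
proof -
  obtain L where L: "square_integrable M X" "\<forall>n. linear_combination (L n)" "ms_limit M L X"
    using assms(1) by (rule gaussian_spaceE)
  obtain L' where L': "square_integrable M Y" "\<forall>n. linear_combination (L' n)" "ms_limit M L' Y"
    using assms(2) by (rule gaussian_spaceE)
  note comb = L(2)[rule_format] L'(2)[rule_format]
  have "ms_limit M (\<lambda>n \<omega>. L n \<omega> + L' n \<omega>) (\<lambda>\<omega>. X \<omega> + Y \<omega>)"
    by (intro ms_limit_add L L' linear_combination_char(1) comb)
  then show ?thesis
    by (rule gaussian_spaceI[rotated 2]) (intro square_integrable_add linear_combination_add L L' comb)+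
qed

lemma gaussian_space_sum:
  "(\<And>j. j \<in> J \<Longrightarrow> X j \<in> gaussian_space) \<Longrightarrow> (\<lambda>\<omega>. \<Sum>j\<in>J. X j \<omega>) \<in> gaussian_space"
proof (induction J rule: infinite_finite_induct)
  case (insert j J)
  then show ?case using gaussian_space_add[of "X j"] by simp
qed (auto simp: ms_limit_def mean_product_def square_integrable_def
      intro!: gaussian_spaceI[where L="\<lambda>n \<omega>. 0"] linear_combination_0)

text \<open>Riemann sums for \<open>\<integral> x t trig i t dt\<close>. The integral is formed as their mean-square limit, because the paths of
  \<open>x\<close> need not be measurable. For \<open>N = 0\<close> the sum is 0.\<close>

definition riemann_sum :: "bool \<times> nat \<Rightarrow> nat \<Rightarrow> 'a \<Rightarrow> real" where
  "riemann_sum i N \<omega> = (\<Sum>j<N. trig i (real j / real N) / real N * x (real j / real N) \<omega>)"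

lemma grid: "j < N \<Longrightarrow> real j / real N \<in> {0..1}"
  by (auto simp: divide_simps)

lemma linear_combination_riemann_sum: "linear_combination (riemann_sum i N)"
  unfolding riemann_sum_def[abs_def]
  by (intro linear_combination_sum linear_combination_cmult linear_combination_x grid) auto

lemmas square_integrable_riemann_sum = linear_combination_char(1)[OF linear_combination_riemann_sum]

lemma mean_product_riemann_sum:
  assumes "square_integrable M X"
  shows "mean_product M X (riemann_sum i N) =
    (\<Sum>j<N. trig i (real j / real N) * mean_product M X (x (real j / real N))) / real N"
proof -
  have "mean_product M X (riemann_sum i N) =
      (\<Sum>j<N. mean_product M X (\<lambda>\<omega>. trig i (real j / real N) / real N * x (real j / real N) \<omega>))"
    unfolding riemann_sum_def[abs_def]
    by (intro mean_product_sum assms square_integrable_cmult square_integrable_x grid) auto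
  then show ?thesis unfolding mean_product_cmult by (simp add: sum_divide_distrib)
qed

lemma C_commute: "s \<in> {0..1} \<Longrightarrow> t \<in> {0..1} \<Longrightarrow> C (s - t) = C (t - s)"
  using covariance[of s t] covariance[of t s] mean_product_commute by metis

text \<open>The covariance of \<open>x t\<close> with the Riemann sum is itself a Riemann sum for \<open>\<integral> C (s - t) trig i s ds\<close>, which the
  eigenfunction property evaluates. Uniformity in \<open>t\<close> is needed because \<open>t\<close> will run through the nodes of a
  second Riemann sum.\<close>

lemma mean_product_x_riemann_sum:
  assumes "0 < e"
  obtains N0 where "\<And>N t. N0 \<le> N \<Longrightarrow> t \<in> {0..1} \<Longrightarrow>
    \<bar>mean_product M (x t) (riemann_sum i N) - coef (snd i) * trig i t\<bar> \<le> e"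
proof -
  have "continuous_on ({0..1} \<times> {0..1}) (\<lambda>(s, t). C (s - t) * trig i s)"
    unfolding case_prod_beta
    by (intro continuous_intros continuous_on_compose2[OF cont]) (auto intro!: continuous_intros)
  from Riemann_sum_uniform[OF this assms] obtain N0 where N0: "\<And>N t. N0 \<le> N \<Longrightarrow> t \<in> {0..1} \<Longrightarrow>
    \<bar>(\<Sum>j<N. C (real j / real N - t) * trig i (real j / real N)) / real N - integral {0..1} (\<lambda>s. C (s - t) * trig i s)\<bar> \<le> e"
    by blast
  show ?thesis
  proof (rule that)
    fix N t assume N: "N0 \<le> N" "t \<in> {0..1::real}"
    have "(\<Sum>j<N. trig i (real j / real N) * mean_product M (x t) (x (real j / real N))) =
        (\<Sum>j<N. C (real j / real N - t) * trig i (real j / real N))"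
      using N by (intro sum.cong) (auto simp: covariance grid C_commute)
    then show "\<bar>mean_product M (x t) (riemann_sum i N) - coef (snd i) * trig i t\<bar> \<le> e"
      using N0[OF N] N(2) by (simp add: mean_product_riemann_sum square_integrable_x trig_eigenfunction)
  qed
qed

lemma abs_trig_le: "\<bar>trig i t\<bar> \<le> 2"
proof -
  have "sqrt 2 \<le> 2" by (rule real_le_lsqrt) auto
  have "\<bar>sqrt 2 * y\<bar> \<le> 2" if "\<bar>y\<bar> \<le> 1" for y
    using mult_mono[OF \<open>sqrt 2 \<le> 2\<close> that] by (simp add: abs_mult)
  then show ?thesis by (cases i) (simp add: trig_def)
qed

lemma integral_trig_mult_trig:
  "integral {0..1} (\<lambda>s. trig i s * trig j s) = of_bool (i = j \<and> i \<noteq> (False, 0))"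
proof -
  obtain b k b' l where ij: "i = (b, k)" "j = (b', l)" by (cases i, cases j)
  have sc: "integral {0..1} (\<lambda>s. sin (2 * real k * pi * s) * cos (2 * real l * pi * s)) = 0" for k l
  proof -
    have "integral {0..1} (\<lambda>s. sin (2 * real k * pi * s) * cos (2 * real l * pi * s)) =
        integral {0..1} (\<lambda>s. sin (2 * real k * pi * (1 - s)) * cos (2 * real l * pi * (1 - s)))"
      by (rule integral_reflect_unit[symmetric])
    also have "\<dots> = integral {0..1} (\<lambda>s. - (sin (2 * real k * pi * s) * cos (2 * real l * pi * s)))"
      by (simp add: right_diff_distrib sin_diff cos_diff)
    finally show ?thesis by simp
  qed
  have cs: "integral {0..1} (\<lambda>s. cos (2 * real k * pi * s) * sin (2 * real l * pi * s)) = 0" for k l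
    using sc[of l k] by (simp add: mult.commute)
  have s2: "integral {0..1} (\<lambda>s. sqrt 2 * f s * (sqrt 2 * g s)) = 2 * integral {0..1} (\<lambda>s. f s * g s)"
    for f g :: "real \<Rightarrow> real"
  proof -
    have "(\<lambda>s. sqrt 2 * f s * (sqrt 2 * g s)) = (\<lambda>s. 2 * (f s * g s))"
      by (simp add: fun_eq_iff mult_ac)
    then show ?thesis by simp
  qed
  show ?thesis
    unfolding ij trig_def
    by (cases "k = 0"; cases "l = 0"; cases b; cases b')
       (auto simp: s2 sc cs integral_cos_mult_cos integral_sin_mult_sin integral_cos_period integral_sin_period)
qed

lemma trig_grid_orthogonal:
  "(\<lambda>N. (\<Sum>m<N. trig i (real m / real N) * trig j (real m / real N)) / real N)
    \<longlonglongrightarrow> of_bool (i = j \<and> i \<noteq> (False, 0))"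
proof (rule LIMSEQ_I)
  fix e :: real assume "0 < e"
  have "continuous_on ({0..1} \<times> {0..1}) (\<lambda>(s, t::real). trig i s * trig j s)"
    unfolding case_prod_beta
    by (intro continuous_intros)
  from Riemann_sum_uniform[OF this, of "e / 2"] \<open>0 < e\<close>
  obtain N0 where "\<And>N t. N0 \<le> N \<Longrightarrow> t \<in> {0..1::real} \<Longrightarrow>
    \<bar>(\<Sum>m<N. trig i (real m / real N) * trig j (real m / real N)) / real N - integral {0..1} (\<lambda>s. trig i s * trig j s)\<bar> \<le> e / 2"
    by auto
  from this[of _ 0] \<open>0 < e\<close> show "\<exists>N0. \<forall>N\<ge>N0. norm ((\<Sum>m<N. trig i (real m / real N) * trig j (real m / real N)) / real N -
     of_bool (i = j \<and> i \<noteq> (False, 0))) < e"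
    unfolding integral_trig_mult_trig by (intro exI[of _ N0] allI impI) (fastforce simp: le_less_trans)
qed

text \<open>The double Riemann sum is reduced to a single one: up to a uniform error the inner sum is an eigenvalue times a
  basis function, and the outer sum then tests orthonormality on the grid.\<close>

lemma mean_product_riemann_sums:
  assumes "0 < e"
  obtains N0 where "\<And>N N'. N0 \<le> N \<Longrightarrow> N0 \<le> N' \<Longrightarrow>
    \<bar>mean_product M (riemann_sum i N) (riemann_sum i N') - coef (snd i) * of_bool (i \<noteq> (False, 0))\<bar> < e"
proof -
  define T where "T N = (\<Sum>m<N. trig i (real m / real N) * trig i (real m / real N)) / real N" for N
  \<comment> \<open>The quarter of \<open>e\<close> is doubled by the bound 2 on the basis functions; the other half of \<open>e\<close> goes to the outer sum.\<close>
  obtain N1 where N1: "\<And>N t. N1 \<le> N \<Longrightarrow> t \<in> {0..1} \<Longrightarrow>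
    \<bar>mean_product M (x t) (riemann_sum i N) - coef (snd i) * trig i t\<bar> \<le> e / 4"
    using mean_product_x_riemann_sum[of "e / 4" i] assms by auto
  have "(\<lambda>N. coef (snd i) * T N) \<longlonglongrightarrow> coef (snd i) * of_bool (i \<noteq> (False, 0))"
    using trig_grid_orthogonal[of i i] unfolding T_def by (intro tendsto_mult_left) simp
  from LIMSEQ_D[OF this, of "e / 2"] assms obtain N2 where N2: "\<And>N. N2 \<le> N \<Longrightarrow>
    \<bar>coef (snd i) * T N - coef (snd i) * of_bool (i \<noteq> (False, 0))\<bar> < e / 2" by auto
  show ?thesis
  proof (rule that[of "Suc (max N1 N2)"])
    fix N N' assume N: "Suc (max N1 N2) \<le> N" "Suc (max N1 N2) \<le> N'"
    let ?t = "\<lambda>m. real m / real N'"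
    let ?D = "\<lambda>m. mean_product M (x (?t m)) (riemann_sum i N) - coef (snd i) * trig i (?t m)"
    have "mean_product M (riemann_sum i N) (riemann_sum i N') - coef (snd i) * T N' =
        (\<Sum>m<N'. trig i (?t m) * ?D m) / real N'"
      unfolding mean_product_riemann_sum[OF square_integrable_riemann_sum] T_def
      by (simp add: mean_product_commute[of M "riemann_sum i N"] right_diff_distrib sum_subtractf diff_divide_distrib
          sum_distrib_left mult_ac)
    also have "\<bar>\<dots>\<bar> \<le> (\<Sum>m<N'. 2 * (e / 4)) / real N'"
    proof -
      have "\<bar>\<Sum>m<N'. trig i (?t m) * ?D m\<bar> \<le> (\<Sum>m<N'. 2 * (e / 4))"
      proof (rule order_trans[OF sum_abs sum_mono])
        fix m assume "m \<in> {..<N'}"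
        then show "\<bar>trig i (?t m) * ?D m\<bar> \<le> 2 * (e / 4)"
          unfolding abs_mult using N N1[of N "?t m"] grid abs_trig_le by (intro mult_mono) auto
      qed
      then show ?thesis using N by (simp add: divide_right_mono del: sum_constant)
    qed
    also have "\<dots> = e / 2" using N by simp
    finally show "\<bar>mean_product M (riemann_sum i N) (riemann_sum i N') - coef (snd i) * of_bool (i \<noteq> (False, 0))\<bar> < e"
      using N2[of N'] N by linarith
  qed
qed

text \<open>The random Fourier coefficients of \<open>x\<close>. The covariances of two Riemann sums for the same integral converge to a
  common limit, so these sums are Cauchy in mean square. Their limits inherit the covariances with \<open>x t\<close>, and
  these determine, through one more Riemann sum, the covariances among the limits.\<close>

theorem fourier_variables:
  obtains \<xi> where "\<And>i. \<xi> i \<in> gaussian_space"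
    and "\<And>i t. t \<in> {0..1} \<Longrightarrow> mean_product M (x t) (\<xi> i) = coef (snd i) * trig i t"
    and "\<And>i j. mean_product M (\<xi> i) (\<xi> j) = coef (snd i) * of_bool (i = j \<and> i \<noteq> (False, 0))"
proof -
  have "\<exists>Y. square_integrable M Y \<and> ms_limit M (riemann_sum i) Y" for i
  proof -
    have "\<exists>N0. \<forall>m\<ge>N0. \<forall>n\<ge>N0. mean_product M (\<lambda>\<omega>. riemann_sum i m \<omega> - riemann_sum i n \<omega>)
        (\<lambda>\<omega>. riemann_sum i m \<omega> - riemann_sum i n \<omega>) < e" if "e > 0" for e
    proof -
      obtain N0 where N0: "\<And>N N'. N0 \<le> N \<Longrightarrow> N0 \<le> N' \<Longrightarrow>
          \<bar>mean_product M (riemann_sum i N) (riemann_sum i N') - coef (snd i) * of_bool (i \<noteq> (False, 0))\<bar> < e / 4"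
        using mean_product_riemann_sums[of "e / 4" i] \<open>e > 0\<close> by auto
      have "mean_product M (\<lambda>\<omega>. riemann_sum i m \<omega> - riemann_sum i n \<omega>) (\<lambda>\<omega>. riemann_sum i m \<omega> - riemann_sum i n \<omega>) < e"
        if "m \<ge> N0" "n \<ge> N0" for m n
        unfolding mean_square_diff[OF square_integrable_riemann_sum square_integrable_riemann_sum]
        using N0[of m m] N0[of m n] N0[of n n] that by linarith
      then show ?thesis by blast
    qed
    then obtain Y where "square_integrable M Y" "ms_limit M (riemann_sum i) Y"
      by (rule square_integrable_complete[OF square_integrable_riemann_sum])
    then show ?thesis by blast
  qed
  then obtain \<xi> where \<xi>: "\<And>i. square_integrable M (\<xi> i)" and lim: "\<And>i. ms_limit M (riemann_sum i) (\<xi> i)"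
    by metis
  have x\<xi>: "mean_product M (x t) (\<xi> i) = coef (snd i) * trig i t" if t: "t \<in> {0..1}" for i t
  proof (rule LIMSEQ_unique)
    show "(\<lambda>N. mean_product M (x t) (riemann_sum i N)) \<longlonglongrightarrow> mean_product M (x t) (\<xi> i)"
      using t by (intro mean_product_tendsto_ms_limit square_integrable_x square_integrable_riemann_sum \<xi> lim)
    show "(\<lambda>N. mean_product M (x t) (riemann_sum i N)) \<longlonglongrightarrow> coef (snd i) * trig i t"
    proof (rule LIMSEQ_I)
      fix e :: real assume "0 < e"
      then obtain N0 where "\<And>N t. N0 \<le> N \<Longrightarrow> t \<in> {0..1} \<Longrightarrow>
          \<bar>mean_product M (x t) (riemann_sum i N) - coef (snd i) * trig i t\<bar> \<le> e / 2"
        using mean_product_x_riemann_sum[of "e / 2" i] by auto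
      with t \<open>0 < e\<close> show "\<exists>N0. \<forall>N\<ge>N0. norm (mean_product M (x t) (riemann_sum i N) - coef (snd i) * trig i t) < e"
        by (intro exI[of _ N0]) (fastforce simp: le_less_trans)
    qed
  qed
  have \<xi>\<xi>: "mean_product M (\<xi> i) (\<xi> j) = coef (snd i) * of_bool (i = j \<and> i \<noteq> (False, 0))" for i j
  proof (rule LIMSEQ_unique)
    show "(\<lambda>N. mean_product M (\<xi> i) (riemann_sum j N)) \<longlonglongrightarrow> mean_product M (\<xi> i) (\<xi> j)"
      by (intro mean_product_tendsto_ms_limit square_integrable_riemann_sum \<xi> lim)
    have "mean_product M (\<xi> i) (riemann_sum j N) =
        coef (snd i) * ((\<Sum>m<N. trig i (real m / real N) * trig j (real m / real N)) / real N)" for N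
    proof -
      have "(\<Sum>m<N. trig j (real m / real N) * mean_product M (\<xi> i) (x (real m / real N))) =
          (\<Sum>m<N. coef (snd i) * (trig i (real m / real N) * trig j (real m / real N)))"
        by (intro sum.cong) (auto simp: mean_product_commute[of M "\<xi> i"] x\<xi> grid)
      then show ?thesis
        unfolding mean_product_riemann_sum[OF \<xi>] by (simp add: sum_distrib_left)
    qed
    then show "(\<lambda>N. mean_product M (\<xi> i) (riemann_sum j N)) \<longlonglongrightarrow> coef (snd i) * of_bool (i = j \<and> i \<noteq> (False, 0))"
      by (simp only:) (intro tendsto_mult_left trig_grid_orthogonal)
  qed
  have "\<xi> i \<in> gaussian_space" for i
    by (rule gaussian_spaceI[OF \<xi> linear_combination_riemann_sum lim])
  then show ?thesis using x\<xi> \<xi>\<xi> by (rule that)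
qed

lemma coef_nonneg: "0 \<le> coef k"
proof -
  obtain \<xi> where "\<And>i j. mean_product M (\<xi> i) (\<xi> j) = coef (snd i) * of_bool (i = j \<and> i \<noteq> (False, 0))"
    by (rule fourier_variables) blast
  from this[of "(True, k)" "(True, k)"] mean_product_nonneg[of M "\<xi> (True, k)"] show ?thesis by simp
qed

text \<open>Pythagoras: the remainder is orthogonal to the partial sum.\<close>

lemma mean_square_remainder:
  assumes sq: "\<And>i. square_integrable M (\<xi> i)"
    and x\<xi>: "\<And>i t. t \<in> {0..1} \<Longrightarrow> mean_product M (x t) (\<xi> i) = coef (snd i) * trig i t"
    and \<xi>\<xi>: "\<And>i j. mean_product M (\<xi> i) (\<xi> j) = coef (snd i) * of_bool (i = j \<and> i \<noteq> (False, 0))"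
    and I: "finite I" and t: "t \<in> {0..1}"
  shows "mean_product M (\<lambda>\<omega>. x t \<omega> - (\<Sum>i\<in>I. trig i t * \<xi> i \<omega>)) (\<lambda>\<omega>. x t \<omega> - (\<Sum>i\<in>I. trig i t * \<xi> i \<omega>)) =
    C 0 - (\<Sum>i\<in>I. coef (snd i) * (trig i t)\<^sup>2)"
proof -
  let ?S = "\<lambda>\<omega>. \<Sum>i\<in>I. trig i t * \<xi> i \<omega>"
  have S: "square_integrable M ?S" by (intro square_integrable_sum square_integrable_cmult sq)
  have "mean_product M (x t) ?S = (\<Sum>i\<in>I. coef (snd i) * (trig i t)\<^sup>2)"
    using t by (subst mean_product_sum)
      (auto simp: square_integrable_x square_integrable_cmult sq mean_product_cmult x\<xi> power2_eq_square mult_ac intro!: sum.cong)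
  moreover have "mean_product M ?S ?S = (\<Sum>i\<in>I. coef (snd i) * (trig i t)\<^sup>2)"
  proof -
    have "mean_product M (\<xi> i) ?S = coef (snd i) * trig i t" if "i \<in> I" for i
    proof -
      have "mean_product M (\<xi> i) ?S = (\<Sum>j\<in>I. trig j t * (coef (snd i) * of_bool (i = j \<and> i \<noteq> (False, 0))))"
        by (subst mean_product_sum) (auto simp: square_integrable_cmult sq mean_product_cmult \<xi>\<xi>)
      also have "\<dots> = (\<Sum>j\<in>I. if j = i then coef (snd i) * trig i t else 0)"
        by (intro sum.cong) (auto simp: trig_def)
      finally show ?thesis using I that by simp
    qed
    then have "mean_product M ?S (\<lambda>\<omega>. trig i t * \<xi> i \<omega>) = coef (snd i) * (trig i t)\<^sup>2" if "i \<in> I" for i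
      using that by (simp add: mean_product_cmult mean_product_commute[of M ?S "\<xi> i"] power2_eq_square)
    then show ?thesis
      by (subst mean_product_sum) (auto simp: S square_integrable_cmult sq)
  qed
  ultimately show ?thesis
    using t by (simp add: mean_square_diff square_integrable_x S covariance)
qed

text \<open>As \<open>sin\<^sup>2 + cos\<^sup>2 = 1\<close>, the partial sums of the variance do not depend on \<open>t\<close>; this makes the convergence in
  the expansion uniform.\<close>

lemma sum_coef_trig:
  "(\<Sum>i\<in>UNIV \<times> {..n}. coef (snd i) * (trig i t)\<^sup>2) = coef 0 + 2 * (\<Sum>k=1..n. coef k)"
proof -
  have "(\<Sum>i\<in>UNIV \<times> {..n}. coef (snd i) * (trig i t)\<^sup>2) =
      (\<Sum>k\<le>n. \<Sum>b\<in>UNIV. coef k * (trig (b, k) t)\<^sup>2)"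
    by (simp add: sum.cartesian_product' sum.swap[of _ UNIV] case_prod_beta)
  also have "\<dots> = (\<Sum>k\<le>n. if k = 0 then coef 0 else 2 * coef k)"
  proof (intro sum.cong refl)
    fix k
    let ?y = "2 * real k * pi * t"
    have "coef k * (2 * (sin ?y)\<^sup>2) + coef k * (2 * (cos ?y)\<^sup>2) = 2 * coef k * ((sin ?y)\<^sup>2 + (cos ?y)\<^sup>2)"
      by (simp only: algebra_simps)
    then show "(\<Sum>b\<in>UNIV. coef k * (trig (b, k) t)\<^sup>2) = (if k = 0 then coef 0 else 2 * coef k)"
      by (simp add: UNIV_bool trig_def power_mult_distrib)
  qed
  also have "\<dots> = coef 0 + (\<Sum>k=1..n. if k = 0 then coef 0 else 2 * coef k)"
    by (simp add: atMost_atLeast0 sum.atLeast_Suc_atMost)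
  also have "(\<Sum>k=1..n. if k = 0 then coef 0 else 2 * coef k) = (\<Sum>k=1..n. 2 * coef k)"
    by (intro sum.cong) auto
  finally show ?thesis by (simp add: sum_distrib_left)
qed

text \<open>The mean square of the remainder is nonnegative, which gives the bound on the partial sums (Bessel's inequality)
  that convergence of the cosine series requires.\<close>

lemma coef_sums_variance:
  "summable coef" "(\<lambda>n. coef 0 + 2 * (\<Sum>k=1..n. coef k)) \<longlonglongrightarrow> C 0"
proof -
  obtain \<xi> where \<xi>: "\<And>i. \<xi> i \<in> gaussian_space"
    and "\<And>i t. t \<in> {0..1} \<Longrightarrow> mean_product M (x t) (\<xi> i) = coef (snd i) * trig i t"
    and "\<And>i j. mean_product M (\<xi> i) (\<xi> j) = coef (snd i) * of_bool (i = j \<and> i \<noteq> (False, 0))"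
    by (rule fourier_variables) blast
  moreover have "square_integrable M (\<xi> i)" for i using \<xi>[of i] by (simp add: gaussian_space_def)
  ultimately have "0 \<le> C 0 - (\<Sum>i\<in>UNIV \<times> {..n}. coef (snd i) * (trig i 0)\<^sup>2)" for n
    using mean_square_remainder[of \<xi> "UNIV \<times> {..n}" 0] mean_product_nonneg by (metis (no_types, lifting) atLeastAtMost_iff finite_SigmaI finite_atMost finite_class.finite_UNIV order_refl zero_le_one)
  then have "coef 0 + 2 * (\<Sum>k=1..n. coef k) \<le> C 0" for n by (simp add: sum_coef_trig)
  from coef_sums[OF coef_nonneg this]
  show "summable coef" "(\<lambda>n. coef 0 + 2 * (\<Sum>k=1..n. coef k)) \<longlonglongrightarrow> C 0" .
qed

end

section \<open>Gaussian noise\<close>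

abbreviation gaussian_noise :: "(nat \<Rightarrow> real) measure" where
  "gaussian_noise \<equiv> \<Pi>\<^sub>M n\<in>UNIV. std_normal_distribution"

lemma prob_space_std_normal: "prob_space std_normal_distribution"
  by (rule prob_space_normal_density) simp

lemma prob_space_gaussian_noise: "prob_space gaussian_noise"
  by (intro prob_space_PiM prob_space_std_normal)

lemma indep_vars_gaussian_noise:
  "prob_space.indep_vars gaussian_noise (\<lambda>_. borel) (\<lambda>n y. y n) UNIV"
proof -
  interpret P: prob_space gaussian_noise by (rule prob_space_gaussian_noise)
  have comp: "distr gaussian_noise std_normal_distribution (\<lambda>y. y n) = std_normal_distribution" for n
    by (rule distr_PiM_component) (auto intro: prob_space_std_normal)
  have "P.indep_vars (\<lambda>_. std_normal_distribution) (\<lambda>n y. y n) UNIV"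
    by (subst P.indep_vars_iff_distr_eq_PiM') (simp_all add: comp distr_id restrict_UNIV)
  then show ?thesis
    by (rule P.indep_vars_compose2[where Y="\<lambda>_ v. v"]) simp
qed

text \<open>The coordinates of a product measure are independent, so the characteristic function is a product.\<close>

lemma gaussian_noise_char:
  assumes "finite D"
  shows "(\<integral>y. iexp (\<Sum>n\<in>D. s n * y n) \<partial>gaussian_noise) = of_real (exp (- (\<Sum>n\<in>D. (s n)\<^sup>2) / 2))"
proof -
  interpret P: prob_space gaussian_noise by (rule prob_space_gaussian_noise)
  have [measurable]: "(\<lambda>y. y n) \<in> borel_measurable gaussian_noise" for n
    using measurable_component_singleton[of n UNIV "\<lambda>_. std_normal_distribution"] by simp
  have "P.indep_vars (\<lambda>_. borel) (\<lambda>n y. s n * y n) D"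
    by (rule P.indep_vars_compose2[OF P.indep_vars_subset[OF indep_vars_gaussian_noise]]) auto
  from P.char_distr_sum[OF this, of 1]
  have "(\<integral>y. iexp (\<Sum>n\<in>D. s n * y n) \<partial>gaussian_noise) = (\<Prod>n\<in>D. (\<integral>y. iexp (s n * y n) \<partial>gaussian_noise))"
    by (simp add: char_def integral_distr)
  also have "\<dots> = (\<Prod>n\<in>D. of_real (exp (- (s n)\<^sup>2 / 2)))"
  proof (intro prod.cong refl)
    fix n
    have "(\<integral>y. iexp (s n * y n) \<partial>gaussian_noise) =
        char (distr gaussian_noise std_normal_distribution (\<lambda>y. y n)) (s n)"
      by (simp add: char_def integral_distr)
    also have "distr gaussian_noise std_normal_distribution (\<lambda>y. y n) = std_normal_distribution"
      by (rule distr_PiM_component) (auto intro: prob_space_std_normal)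
    finally show "(\<integral>y. iexp (s n * y n) \<partial>gaussian_noise) = of_real (exp (- (s n)\<^sup>2 / 2))"
      by (simp add: char_std_normal_distribution)
  qed
  also have "\<dots> = of_real (exp (\<Sum>n\<in>D. - (s n)\<^sup>2 / 2))"
    using assms by (simp add: exp_sum)
  also have "(\<Sum>n\<in>D. - (s n)\<^sup>2 / 2) = - (\<Sum>n\<in>D. (s n)\<^sup>2) / 2"
    by (simp add: sum_negf sum_divide_distrib)
  finally show ?thesis .
qed

lemma (in prob_space) integral_enlargement_mult:
  fixes f :: "'a \<Rightarrow> complex" and g :: "(nat \<Rightarrow> real) \<Rightarrow> complex"
  assumes "integrable M f" "integrable gaussian_noise g"
  shows "(\<integral>\<omega>. f (fst \<omega>) * g (snd \<omega>) \<partial>enlargement M) = (\<integral>\<omega>. f \<omega> \<partial>M) * (\<integral>y. g y \<partial>gaussian_noise)"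
proof -
  interpret N: prob_space gaussian_noise by (rule prob_space_gaussian_noise)
  interpret pair_prob_space M gaussian_noise ..
  have "integrable (M \<Otimes>\<^sub>M gaussian_noise) (\<lambda>\<omega>. f (fst \<omega>) * g (snd \<omega>))"
  proof (rule Fubini_integrable)
    show "(\<lambda>\<omega>. f (fst \<omega>) * g (snd \<omega>)) \<in> borel_measurable (M \<Otimes>\<^sub>M gaussian_noise)"
      using assms by measurable
  qed (use assms in \<open>auto simp: norm_mult\<close>)
  from integral_fst'[OF this] show ?thesis by (simp add: enlargement_def)
qed

lemma (in prob_space) nn_integral_enlargement_fst:
  assumes "f \<in> borel_measurable M"
  shows "(\<integral>\<^sup>+\<omega>. f (fst \<omega>) \<partial>enlargement M) = (\<integral>\<^sup>+\<omega>. f \<omega> \<partial>M)"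
proof -
  interpret N: prob_space gaussian_noise by (rule prob_space_gaussian_noise)
  have "(\<integral>\<^sup>+\<omega>. f \<omega> \<partial>M) = (\<integral>\<^sup>+\<omega>. f \<omega> \<partial>distr (enlargement M) M fst)"
    by (simp add: enlargement_def N.distr_pair_fst)
  also have "\<dots> = (\<integral>\<^sup>+\<omega>. f (fst \<omega>) \<partial>enlargement M)"
    using assms by (intro nn_integral_distr) (auto simp: enlargement_def)
  finally show ?thesis ..
qed

lemma (in prob_space) prob_space_enlargement: "prob_space (enlargement M)"
  unfolding enlargement_def by (intro prob_space_pair prob_space_axioms prob_space_gaussian_noise)

lemma (in prob_space) indep_vars_inj_reindex:
  assumes f: "inj f" and indep: "indep_vars (\<lambda>_. N) X UNIV"
  shows "indep_vars (\<lambda>_. N) (\<lambda>k. X (f k)) UNIV"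
proof -
  let ?F = "\<lambda>i. {X i -` A \<inter> space M |A. A \<in> sets N}"
  have X: "random_variable N (X i)" for i
    using indep by (simp add: indep_vars_def2)
  have ind: "indep_sets ?F UNIV"
    using indep by (simp add: indep_vars_def2)
  have "indep_sets (\<lambda>k. ?F (f k)) UNIV"
  proof (rule indep_setsI)
    fix A J assume J: "finite J" "J \<noteq> {}" "\<forall>j\<in>J. A j \<in> ?F (f j)"
    have "prob (\<Inter>i\<in>f ` J. A (inv f i)) = (\<Prod>i\<in>f ` J. prob (A (inv f i)))"
      by (rule indep_setsD[OF ind]) (use J f in auto)
    then show "prob (\<Inter>j\<in>J. A j) = (\<Prod>j\<in>J. prob (A j))"
      using f by (simp add: prod.reindex inj_on_subset)
  qed (use X in \<open>auto intro: measurable_sets\<close>)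
  then show ?thesis using X by (simp add: indep_vars_def2)
qed

text \<open>Variables with disjoint sets of indices form independent blocks.\<close>

lemma (in prob_space) split_iid_std_gaussian:
  fixes Z :: "bool \<times> nat \<Rightarrow> 'a \<Rightarrow> real"
  assumes std: "\<And>i. standard_gaussian_rv M (Z i)" and indep: "indep_vars (\<lambda>_. borel) Z UNIV"
  shows "iid_standard_gaussian M (\<lambda>k. Z (b, k))"
    and "independent_sequences M (\<lambda>k. Z (False, k)) (\<lambda>k. Z (True, k))"
proof -
  have "indep_vars (\<lambda>_. borel) (\<lambda>k. Z (b, k)) UNIV"
    by (rule indep_vars_inj_reindex[OF _ indep]) (simp add: inj_on_def)
  then show "iid_standard_gaussian M (\<lambda>k. Z (b, k))"
    using std by (simp add: iid_standard_gaussian_def)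
  let ?A = "\<lambda>b. {b} \<times> (UNIV :: nat set)"
  have "indep_var (PiM (?A False) (\<lambda>_. borel)) (\<lambda>\<omega>. restrict (\<lambda>i. Z i \<omega>) (?A False))
      (PiM (?A True) (\<lambda>_. borel)) (\<lambda>\<omega>. restrict (\<lambda>i. Z i \<omega>) (?A True))"
    by (rule indep_var_restrict[OF indep]) auto
  moreover have drop: "(\<lambda>y n. y (b, n)) \<in> measurable (PiM (?A b) (\<lambda>_. borel)) (PiM UNIV (\<lambda>_. borel))" for b
    by (rule measurable_PiM_single') (auto simp: space_PiM)
  ultimately have "indep_var (PiM UNIV (\<lambda>_. borel)) ((\<lambda>y n. y (False, n)) \<circ> (\<lambda>\<omega>. restrict (\<lambda>i. Z i \<omega>) (?A False)))
      (PiM UNIV (\<lambda>_. borel)) ((\<lambda>y n. y (True, n)) \<circ> (\<lambda>\<omega>. restrict (\<lambda>i. Z i \<omega>) (?A True)))"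
    by (intro indep_var_compose[OF _ drop drop])
  then show "independent_sequences M (\<lambda>k. Z (False, k)) (\<lambda>k. Z (True, k))"
    by (simp add: independent_sequences_def o_def)
qed

section \<open>The expansion\<close>

context periodic_gaussian_process
begin

text \<open>The normalized Fourier coefficients \<open>\<xi> i / c (snd i)\<close> serve as Gaussian variables where they exist, at the
  indices called live; at the other indices independent noise is substituted. All linear combinations of
  the resulting family \<open>Z\<close> have the characteristic function of independent standard normal variables.
  At a live index \<open>c k * Z (b, k)\<close> is \<open>\<xi> (b, k)\<close>, and at the others \<open>c k * trig (b, k) t\<close> vanishes, so the partial
  sums of the series are those of the Fourier expansion of \<open>x\<close>, whose remainder has a mean square
  independent of \<open>t\<close>.\<close>

theorem karhunen_loeve:
  "\<exists>c Y Y'.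
    summable (\<lambda>k. (c k)\<^sup>2) \<and>
    (\<forall>n. (c n)\<^sup>2 = coef n) \<and>
    iid_standard_gaussian (enlargement M) Y \<and>
    iid_standard_gaussian (enlargement M) Y' \<and>
    independent_sequences (enlargement M) Y Y' \<and>
    (\<forall>k. c k \<noteq> 0 \<longrightarrow> lives_on M (Y' k) \<and> (k \<ge> 1 \<longrightarrow> lives_on M (Y k))) \<and>
    ms_converges_uniformly (enlargement M) {0..1}
      (\<lambda>n t \<omega>. c 0 * Y' 0 \<omega> +
        (\<Sum>k=1..n. c k * (Y k \<omega> * sqrt 2 * sin (2 * real k * pi * t) +
                         Y' k \<omega> * sqrt 2 * cos (2 * real k * pi * t))))
      (\<lambda>t \<omega>. x t (fst \<omega>))"
proof -
  obtain \<xi> where \<xi>: "\<And>i. \<xi> i \<in> gaussian_space"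
    and x\<xi>: "\<And>i t. t \<in> {0..1} \<Longrightarrow> mean_product M (x t) (\<xi> i) = coef (snd i) * trig i t"
    and \<xi>\<xi>: "\<And>i j. mean_product M (\<xi> i) (\<xi> j) = coef (snd i) * of_bool (i = j \<and> i \<noteq> (False, 0))"
    by (rule fourier_variables) blast
  have sq: "square_integrable M (\<xi> i)" for i using \<xi>[of i] by (simp add: gaussian_space_def)
  note [measurable] = square_integrable_measurable[OF sq]
  define c where "c k = sqrt (coef k)" for k
  have c2: "(c k)\<^sup>2 = coef k" for k by (simp add: c_def coef_nonneg)
  define live where "live i \<longleftrightarrow> c (snd i) \<noteq> 0 \<and> i \<noteq> (False, 0)" for i :: "bool \<times> nat"
  define Z :: "bool \<times> nat \<Rightarrow> 'a \<times> (nat \<Rightarrow> real) \<Rightarrow> real" where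
    "Z i \<omega> = (if live i then \<xi> i (fst \<omega>) / c (snd i) else snd \<omega> (to_nat i))" for i \<omega>
  interpret P: prob_space gaussian_noise by (rule prob_space_gaussian_noise)
  interpret E: prob_space "enlargement M" by (rule prob_space_enlargement)
  have [measurable]: "(\<lambda>y. y n) \<in> borel_measurable gaussian_noise" for n
    using measurable_component_singleton[of n UNIV "\<lambda>_. std_normal_distribution"] by simp
  have Z_meas: "Z i \<in> borel_measurable (enlargement M)" for i
    unfolding Z_def[abs_def] enlargement_def by measurable
  have live_char: "(\<integral>\<omega>. iexp (\<Sum>i\<in>F. s i * (\<xi> i \<omega> / c (snd i))) \<partial>M) = of_real (exp (- (\<Sum>i\<in>F. (s i)\<^sup>2) / 2))"
    if "finite F" "\<And>i. i \<in> F \<Longrightarrow> live i" for F s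
  proof -
    let ?X = "\<lambda>\<omega>. \<Sum>i\<in>F. s i / c (snd i) * \<xi> i \<omega>"
    have X: "?X \<in> gaussian_space" by (intro gaussian_space_sum gaussian_space_cmult \<xi>)
    have sqX: "square_integrable M ?X" using X by (simp add: gaussian_space_def)
    have "mean_product M ?X (\<lambda>\<omega>. s i / c (snd i) * \<xi> i \<omega>) = (s i)\<^sup>2" if "i \<in> F" for i
    proof -
      have "mean_product M (\<xi> i) ?X = (\<Sum>j\<in>F. s j / c (snd j) * (coef (snd i) * of_bool (i = j \<and> i \<noteq> (False, 0))))"
        by (simp only: mean_product_sum[OF sq square_integrable_cmult[OF sq]] mean_product_cmult \<xi>\<xi>)
      also have "\<dots> = (\<Sum>j\<in>F. if j = i then s i / c (snd i) * coef (snd i) else 0)"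
        using \<open>\<And>i. i \<in> F \<Longrightarrow> live i\<close>[OF \<open>i \<in> F\<close>] by (intro sum.cong) (auto simp: live_def)
      also have "\<dots> = s i / c (snd i) * coef (snd i)" using \<open>finite F\<close> \<open>i \<in> F\<close> by simp
      finally have "mean_product M ?X (\<lambda>\<omega>. s i / c (snd i) * \<xi> i \<omega>) = (s i / c (snd i))\<^sup>2 * (c (snd i))\<^sup>2"
        by (simp only: mean_product_cmult mean_product_commute[of M ?X "\<xi> i"] power2_eq_square c2[unfolded power2_eq_square] mult.assoc)
      then show ?thesis
        using \<open>\<And>i. i \<in> F \<Longrightarrow> live i\<close>[OF \<open>i \<in> F\<close>] by (simp add: live_def power_divide)
    qed
    then have "mean_product M ?X ?X = (\<Sum>i\<in>F. (s i)\<^sup>2)"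
      by (simp only: mean_product_sum[OF sqX square_integrable_cmult[OF sq]] cong: sum.cong)
    then show ?thesis using gaussian_space_char[OF X] by simp
  qed
  have Z_char: "(\<integral>\<omega>. iexp (\<Sum>i\<in>F. s i * Z i \<omega>) \<partial>enlargement M) = of_real (exp (- (\<Sum>i\<in>F. (s i)\<^sup>2) / 2))"
    if F: "finite F" for F s
  proof -
    \<comment> \<open>The live part is a function of the first component, the rest of the second, so Fubini separates them.\<close>
    let ?L = "{i\<in>F. live i}" and ?D = "{i\<in>F. \<not> live i}"
    have split: "(\<Sum>i\<in>F. h i) = (\<Sum>i\<in>?L. h i) + (\<Sum>i\<in>?D. h i)" for h :: "bool \<times> nat \<Rightarrow> real"
      using F by (subst sum.union_disjoint[symmetric]) (auto intro!: sum.cong)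
    have sZ: "(\<Sum>i\<in>F. s i * Z i \<omega>) =
        (\<Sum>i\<in>?L. s i * (\<xi> i (fst \<omega>) / c (snd i))) + (\<Sum>i\<in>?D. s i * snd \<omega> (to_nat i))" for \<omega>
      unfolding split by (intro arg_cong2[where f="(+)"] sum.cong) (auto simp: Z_def)
    have "(\<integral>\<omega>. iexp (\<Sum>i\<in>F. s i * Z i \<omega>) \<partial>enlargement M) =
       (\<integral>\<omega>. iexp (\<Sum>i\<in>?L. s i * (\<xi> i (fst \<omega>) / c (snd i))) * iexp (\<Sum>i\<in>?D. s i * snd \<omega> (to_nat i)) \<partial>enlargement M)"
      unfolding sZ of_real_add distrib_left exp_add ..
    also have "\<dots> = (\<integral>\<omega>. iexp (\<Sum>i\<in>?L. s i * (\<xi> i \<omega> / c (snd i))) \<partial>M) *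
        (\<integral>y. iexp (\<Sum>i\<in>?D. s i * y (to_nat i)) \<partial>gaussian_noise)"
      by (rule integral_enlargement_mult)
         (auto intro!: integrable_const_bound[where B=1] P.integrable_const_bound[where B=1])
    also have "(\<integral>y. iexp (\<Sum>i\<in>?D. s i * y (to_nat i)) \<partial>gaussian_noise) = of_real (exp (- (\<Sum>i\<in>?D. (s i)\<^sup>2) / 2))"
      using gaussian_noise_char[of "to_nat ` ?D" "\<lambda>n. s (from_nat n)"] F
      by (simp add: sum.reindex inj_on_def)
    also have "(\<integral>\<omega>. iexp (\<Sum>i\<in>?L. s i * (\<xi> i \<omega> / c (snd i))) \<partial>M) = of_real (exp (- (\<Sum>i\<in>?L. (s i)\<^sup>2) / 2))"
      using F by (intro live_char) auto
    also have "of_real (exp (- (\<Sum>i\<in>?L. (s i)\<^sup>2) / 2)) * of_real (exp (- (\<Sum>i\<in>?D. (s i)\<^sup>2) / 2)) =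
        (of_real (exp (- (\<Sum>i\<in>F. (s i)\<^sup>2) / 2)) :: complex)"
      unfolding of_real_mult[symmetric] exp_add[symmetric] split[of "\<lambda>i. (s i)\<^sup>2"] by (simp add: add_divide_distrib)
    finally show ?thesis .
  qed
  note Z_iid = E.split_iid_std_gaussian[OF E.iid_std_gaussian_of_char[OF Z_meas Z_char]]
  have lives: "lives_on M (Z i)" if "live i" for i
    unfolding lives_on_def using that
    by (intro bexI[of _ "\<lambda>\<omega>. \<xi> i \<omega> / c (snd i)"]) (auto simp: Z_def fun_eq_iff)
  define S where "S n t \<omega> = c 0 * Z (True, 0) \<omega> +
        (\<Sum>k=1..n. c k * (Z (False, k) \<omega> * sqrt 2 * sin (2 * real k * pi * t) +
                         Z (True, k) \<omega> * sqrt 2 * cos (2 * real k * pi * t)))" for n t \<omega>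
  define R where "R n = C 0 - (coef 0 + 2 * (\<Sum>k=1..n. coef k))" for n
  have S: "S n t \<omega> = (\<Sum>i\<in>{i \<in> UNIV \<times> {..n}. live i}. trig i t * \<xi> i (fst \<omega>))" for n t \<omega>
  proof -
    have "S n t \<omega> = (\<Sum>k\<le>n. \<Sum>b\<in>UNIV. trig (b, k) t * (c k * Z (b, k) \<omega>))"
    proof -
      have "(\<Sum>k\<le>n. \<Sum>b\<in>UNIV. trig (b, k) t * (c k * Z (b, k) \<omega>)) =
          (\<Sum>b\<in>UNIV. trig (b, 0) t * (c 0 * Z (b, 0) \<omega>)) + (\<Sum>k=1..n. \<Sum>b\<in>UNIV. trig (b, k) t * (c k * Z (b, k) \<omega>))"
        by (simp add: atMost_atLeast0 sum.atLeast_Suc_atMost)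
      also have "\<dots> = S n t \<omega>"
        unfolding S_def by (intro arg_cong2[where f="(+)"] sum.cong) (auto simp: UNIV_bool trig_def algebra_simps)
      finally show ?thesis ..
    qed
    also have "\<dots> = (\<Sum>i\<in>UNIV \<times> {..n}. trig i t * (c (snd i) * Z i \<omega>))"
      by (simp add: sum.cartesian_product' sum.swap[of _ UNIV] case_prod_beta)
    also have "\<dots> = (\<Sum>i\<in>{i \<in> UNIV \<times> {..n}. live i}. trig i t * \<xi> i (fst \<omega>))"
      by (intro sum.mono_neutral_cong_right) (auto simp: live_def Z_def trig_def)
    finally show ?thesis .
  qed
  have msq: "(\<integral>\<^sup>+\<omega>. ennreal ((x t (fst \<omega>) - S n t \<omega>)\<^sup>2) \<partial>enlargement M) = ennreal (R n)"
    if t: "t \<in> {0..1}" for n t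
  proof -
    let ?I = "{i \<in> UNIV \<times> {..n}. live i}"
    let ?X = "\<lambda>\<omega>. x t \<omega> - (\<Sum>i\<in>?I. trig i t * \<xi> i \<omega>)"
    have X: "square_integrable M ?X"
      using t by (intro square_integrable_diff square_integrable_sum square_integrable_cmult square_integrable_x sq)
    have "(\<lambda>\<omega>. ennreal ((?X \<omega>)\<^sup>2)) \<in> borel_measurable M"
      by (rule measurable_compose[OF square_integrable_measurable[OF X]]) measurable
    from nn_integral_enlargement_fst[OF this]
    have "(\<integral>\<^sup>+\<omega>. ennreal ((x t (fst \<omega>) - S n t \<omega>)\<^sup>2) \<partial>enlargement M) = (\<integral>\<^sup>+\<omega>. ennreal ((?X \<omega>)\<^sup>2) \<partial>M)"
      by (simp only: S)
    also have "\<dots> = ennreal (mean_product M ?X ?X)" by (rule nn_integral_square[OF X])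
    also have "mean_product M ?X ?X = C 0 - (\<Sum>i\<in>?I. coef (snd i) * (trig i t)\<^sup>2)"
      by (rule mean_square_remainder[OF sq x\<xi> \<xi>\<xi> _ t]) auto
    also have "(\<Sum>i\<in>?I. coef (snd i) * (trig i t)\<^sup>2) = (\<Sum>i\<in>UNIV \<times> {..n}. coef (snd i) * (trig i t)\<^sup>2)"
      by (intro sum.mono_neutral_left) (auto simp: live_def c_def trig_def)
    finally show ?thesis by (simp add: sum_coef_trig R_def)
  qed
  have "R \<longlonglongrightarrow> C 0 - C 0"
    unfolding R_def by (intro tendsto_intros coef_sums_variance)
  then have "(\<lambda>n. ennreal (R n)) \<longlonglongrightarrow> ennreal 0" by (intro tendsto_ennrealI) simp
  moreover have "(SUP t\<in>{0..1}. \<integral>\<^sup>+\<omega>. ennreal ((x t (fst \<omega>) - S n t \<omega>)\<^sup>2) \<partial>enlargement M) = ennreal (R n)" for n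
  proof -
    have "(SUP t\<in>{0..1}. \<integral>\<^sup>+\<omega>. ennreal ((x t (fst \<omega>) - S n t \<omega>)\<^sup>2) \<partial>enlargement M) =
        (SUP t\<in>{0..1::real}. ennreal (R n))"
      by (rule SUP_cong) (simp_all only: msq)
    then show ?thesis by simp
  qed
  ultimately have conv: "ms_converges_uniformly (enlargement M) {0..1} S (\<lambda>t \<omega>. x t (fst \<omega>))"
    by (simp add: ms_converges_uniformly_def)
  show ?thesis
    using coef_sums_variance(1) c2 Z_iid lives conv
    by (intro exI[of _ c] exI[of _ "\<lambda>k. Z (False, k)"] exI[of _ "\<lambda>k. Z (True, k)"])
       (auto simp: S_def[abs_def] live_def)
qed

end

text \<open>Evenness of \<open>Ct\<close> is symmetry of the covariance, its period comes from \<open>x 0 = x 1\<close>, and its continuity from that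
  of the function in the definition of stationarity, which is \<open>Ct\<close> reflected.\<close>

theorem theorem2p2:
  fixes M :: "'a measure" and x :: "real \<Rightarrow> 'a \<Rightarrow> real" and Ct :: "real \<Rightarrow> real"
  assumes "prob_space M"
    and "x \<in> class_H M"
    and "\<forall>s\<in>{0..1}. \<forall>t\<in>{0..1}. covariance M (x s) (x t) = Ct (t - s)"
  shows "\<exists>c Y Y'.
    summable (\<lambda>k. (c k)\<^sup>2) \<and>
    (\<forall>n::nat. (c n)\<^sup>2 = integral {0..1} (\<lambda>s. Ct s * cos (2 * real n * pi * s))) \<and>
    iid_standard_gaussian (enlargement M) Y \<and>
    iid_standard_gaussian (enlargement M) Y' \<and>
    independent_sequences (enlargement M) Y Y' \<and>
    (\<forall>k. c k \<noteq> 0 \<longrightarrow> lives_on M (Y' k) \<and> (k \<ge> 1 \<longrightarrow> lives_on M (Y k))) \<and>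
    ms_converges_uniformly (enlargement M) {0..1}
      (\<lambda>n t \<omega>. c 0 * Y' 0 \<omega> +
        (\<Sum>k=1..n. c k * (Y k \<omega> * sqrt 2 * sin (2 * real k * pi * t) +
                         Y' k \<omega> * sqrt 2 * cos (2 * real k * pi * t))))
      (\<lambda>t \<omega>. x t (fst \<omega>))"
proof -
  interpret prob_space M by fact
  have gaussian: "gaussian_process M {0..1} x"
    and centred: "\<And>t. t \<in> {0..1} \<Longrightarrow> (\<integral>\<omega>. x t \<omega> \<partial>M) = 0"
    and stationary: "continuously_stationary M x"
    and periodic: "AE \<omega> in M. x 0 \<omega> = x 1 \<omega>"
    using assms(2) by (auto simp: class_H_def)
  have [measurable]: "x t \<in> borel_measurable M" if "t \<in> {0..1}" for t
  proof -
    have "gaussian_rv M (\<lambda>\<omega>. \<Sum>s\<in>{t}. 1 * x s \<omega>)"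
      using gaussian[unfolded gaussian_process_def, rule_format, of "{t}" "\<lambda>_. 1"] that by simp
    then show ?thesis by (simp add: gaussian_rv_def)
  qed
  have mp: "mean_product M (x s) (x t) = Ct (t - s)" if "s \<in> {0..1}" "t \<in> {0..1}" for s t
    using assms(3) that centred by (simp add: mean_product_def covariance_def)
  obtain C where C: "continuous_on {-1..1} C"
      "\<And>s t. s \<in> {0..1} \<Longrightarrow> t \<in> {0..1} \<Longrightarrow> covariance M (x s) (x t) = C (s - t)"
    using stationary unfolding continuously_stationary_def by blast
  have Ct: "Ct u = C (- u)" if "u \<in> {-1..1}" for u
  proof -
    \<comment> \<open>Every \<open>u\<close> in \<open>[-1, 1]\<close> is a difference of two points of the unit interval.\<close>
    have "max 0 (- u) \<in> {0..1}" "max 0 u \<in> {0..1}" "max 0 u - max 0 (- u) = u" using that by auto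
    then show ?thesis
      using assms(3) C(2)[of "max 0 (- u)" "max 0 u"] by (metis minus_diff_eq)
  qed
  interpret periodic_gaussian_process M Ct x
  proof
    have "continuous_on {-1..1} (\<lambda>u. C (- u))"
      by (rule continuous_on_compose2[OF C(1)]) (auto intro!: continuous_intros)
    then show "continuous_on {-1..1} Ct" by (subst continuous_on_cong[OF refl Ct])
    fix u :: real assume u: "u \<in> {0..1}"
    show "Ct (- u) = Ct u"
      using mp[of u 0] mp[of 0 u] u mean_product_commute[of M "x u" "x 0"] by simp
    have "mean_product M (x 1) (x u) = mean_product M (x 0) (x u)"
      unfolding mean_product_def using periodic u by (intro integral_cong_AE) auto
    then show "Ct (u - 1) = Ct u" using mp[of 1 u] mp[of 0 u] u by simp
  next
    fix s t :: real assume "s \<in> {0..1}" "t \<in> {0..1}"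
    then show "mean_product M (x s) (x t) = Ct (s - t)"
      using mp[of t s] mean_product_commute[of M "x s" "x t"] by simp
  qed (use gaussian centred in auto)
  show ?thesis using karhunen_loeve unfolding coef_def .
qed

end
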